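(* Let $B$ be a unital $C^\ast$-algebra, $T>0$, and let $\eta:[0,T]\to\mathcal{P}_2(B)$, $t\mapsto\eta_t$, be a $C^1$-path. Let $G:[0,T]\times\mathbb{H}^+(B)\to\mathbb{H}^-(B)$, $(t,b)\mapsto G_t(b)$, be defined by $G_t(b):=G_{\eta_t}(b)$ for all $t\in[0,T]$ and $b\in\mathbb{H}^+(B)$. Endow $[0,T]\times\mathbb{H}^+(B)$ with the product topology. Then, for every fixed $\gamma>0$, the family of maps $[0,T]\to\mathbb{H}^-(B)$, $t\mapsto G_t(b)$, indexed by $b\in\overline{\mathbb{H}^+_\gamma(B)}$, is equidifferentiable, i.e. the time derivatives $\dot{G}_{t_0}(b)$ exist and $$\lim_{t\to t_0}\ \sup_{b\in\overline{\mathbb{H}^+_\gamma(B)}}\Big\|\frac{1}{t-t_0}\big(G_t(b)-G_{t_0}(b)\big)-\dot{G}_{t_0}(b)\Big\|=0\qquad\text{for each }t_0\in[0,T].$$ Moreover, $G$ satisfies the partial differential equation $$\dot{G}_t(b)=-(DG_t)(b)\big(\dot{\eta}_t(G_t(b))\big)\qquad\text{for }(t,b)\in[0,T]\times\mathbb{H}^+(B).$$ In particular, $\dot{G}:[0,T]\times\mathbb{H}^+(B)\to B$, $(t,b)\mapsto\dot{G}_t(b)$, is continuous, and $\dot{G}_t:\mathbb{H}^+(B)\to B$ is holomorphic for every fixed $t\in[0,T]$.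
   Context: $B$ is a unital $C^\ast$-algebra with unit $\mathbf{1}$; $\operatorname{Im}(b)=\frac{1}{2i}(b-b^\ast)$; $\mathbb{H}^\pm(B)=\{b\in B:\exists\,\epsilon>0,\ \pm\operatorname{Im}(b)\geq\epsilon\mathbf{1}\}$; for $\gamma>0$, $\overline{\mathbb{H}^+_\gamma(B)}=\{b\in B:\operatorname{Im}(b)\geq\gamma\mathbf{1}\}$. $\mathcal{L}(B)$ is the Banach space of bounded linear operators on $B$ with the operator norm. A map $\eta:B\to B$ is positive if it is $\mathbb{C}$-linear and maps positive elements to positive elements (automatically bounded); it is $2$-positive if its entrywise amplification $\eta^{(2)}:M_2(B)\to M_2(B)$ is positive. $\mathcal{P}_2(B)\subseteq\mathcal{L}(B)$ is the set of $2$-positive maps, with the operator norm metric. A $C^1$-path in $\mathcal{P}_2(B)$ is a path that is continuously differentiable as an $\mathcal{L}(B)$-valued function on $[0,T]$ (one-sided derivatives at the endpoints); the dot denotes the derivative with respect to $t$, so $\dot\eta_t\in\mathcal{L}(B)$. For each positive $\eta$ there is a unique function $G_\eta:\mathbb{H}^+(B)\to\mathbb{H}^-(B)$ satisfying $bG_\eta(b)=\mathbf{1}+\eta(G_\eta(b))G_\eta(b)$ for all $b\in\mathbb{H}^+(B)$ (the Dyson equation); it is holomorphic, and $(DG_\eta)(b)\in\mathcal{L}(B)$ denotes its Fréchet derivative at $b$; $DG_t:=DG_{\eta_t}$. Holomorphic means Gâteaux holomorphic and locally bounded (equivalently, complex Fréchet differentiable at every point). *)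

theory Defs
  imports "HOL-Analysis.Analysis"
begin

text \<open>
  Unital complex C*-algebras. The real scalar multiplication, which the library's topological
  classes are built on, is the restriction of the complex one.
  The library's class \<open>real_normed_algebra_1\<close> contains \<open>0 \<noteq> 1\<close> and \<open>norm 1 = 1\<close>.
\<close>

class unital_cstar_algebra = real_normed_algebra_1 + banach +
  fixes scaleC :: "complex \<Rightarrow> 'a \<Rightarrow> 'a"  (infixr "*\<^sub>C" 75)
    and star :: "'a \<Rightarrow> 'a"
  assumes scaleR_scaleC: "r *\<^sub>R x = complex_of_real r *\<^sub>C x"
    and scaleC_add_right: "c *\<^sub>C (x + y) = c *\<^sub>C x + c *\<^sub>C y"
    and scaleC_add_left: "(c + d) *\<^sub>C x = c *\<^sub>C x + d *\<^sub>C x"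
    and scaleC_scaleC: "c *\<^sub>C (d *\<^sub>C x) = (c * d) *\<^sub>C x"
    and scaleC_one: "1 *\<^sub>C x = x"
    and norm_scaleC: "norm (c *\<^sub>C x) = cmod c * norm x"
    and mult_scaleC_left: "(c *\<^sub>C x) * y = c *\<^sub>C (x * y)"
    and mult_scaleC_right: "x * (c *\<^sub>C y) = c *\<^sub>C (x * y)"
    and star_star: "star (star x) = x"
    and star_add: "star (x + y) = star x + star y"
    and star_scaleC: "star (c *\<^sub>C x) = cnj c *\<^sub>C star x"
    and star_mult: "star (x * y) = star y * star x"
    and norm_star_mult_self: "norm (star x * x) = (norm x)\<^sup>2"

abbreviation complex_linear ::
    "('a::unital_cstar_algebra \<Rightarrow> 'b::unital_cstar_algebra) \<Rightarrow> bool" where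
  "complex_linear f \<equiv> Vector_Spaces.linear scaleC scaleC f"

definition cstar_positive :: "'a::unital_cstar_algebra \<Rightarrow> bool" where
  "cstar_positive a \<longleftrightarrow> (\<exists>x. a = star x * x)"

definition cstar_le :: "'a::unital_cstar_algebra \<Rightarrow> 'a \<Rightarrow> bool" where
  "cstar_le a b \<longleftrightarrow> cstar_positive (b - a)"

definition cstar_Im :: "'a::unital_cstar_algebra \<Rightarrow> 'a" where
  "cstar_Im b = (1 / (2 * \<i>)) *\<^sub>C (b - star b)"

definition upper_half :: "'a::unital_cstar_algebra set" where
  "upper_half = {b. \<exists>\<epsilon>>0. cstar_le (\<epsilon> *\<^sub>R 1) (cstar_Im b)}"

definition lower_half :: "'a::unital_cstar_algebra set" where
  "lower_half = {b. \<exists>\<epsilon>>0. cstar_le (\<epsilon> *\<^sub>R 1) (- cstar_Im b)}"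

definition upper_half_closed :: "real \<Rightarrow> 'a::unital_cstar_algebra set" where
  "upper_half_closed \<gamma> = {b. cstar_le (\<gamma> *\<^sub>R 1) (cstar_Im b)}"

definition mat2_star :: "'a::unital_cstar_algebra^2^2 \<Rightarrow> 'a^2^2" where
  "mat2_star A = (\<chi> i j. star (A $ j $ i))"

text \<open>
  Positivity in the C*-algebra of 2 by 2 matrices. The condition is purely algebraic, so the
  C*-norm of the matrix algebra (which is not the norm of the type) plays no role.
\<close>

definition mat2_positive :: "'a::unital_cstar_algebra^2^2 \<Rightarrow> bool" where
  "mat2_positive A \<longleftrightarrow> (\<exists>X. A = mat2_star X ** X)"

definition amplification2 ::
    "('a::unital_cstar_algebra \<Rightarrow> 'a) \<Rightarrow> 'a^2^2 \<Rightarrow> 'a^2^2" where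
  "amplification2 f A = (\<chi> i j. f (A $ i $ j))"

definition two_positive :: "('a::unital_cstar_algebra \<Rightarrow> 'a) \<Rightarrow> bool" where
  "two_positive f \<longleftrightarrow>
     complex_linear f \<and> (\<forall>A. mat2_positive A \<longrightarrow> mat2_positive (amplification2 f A))"

text \<open>
  The type of bounded linear functions consists of the real-linear operators. The complex-linear
  ones form a closed subspace of it on which its norm is the usual operator norm, so limits and
  derivatives of paths of complex-linear operators can be taken in this type.
\<close>

definition two_positive_maps :: "('a::unital_cstar_algebra \<Rightarrow>\<^sub>L 'a) set" where
  "two_positive_maps = {\<eta>. two_positive (blinfun_apply \<eta>)}"

definition C1_path_in :: "('a::unital_cstar_algebra \<Rightarrow>\<^sub>L 'a) set \<Rightarrow> real
    \<Rightarrow> (real \<Rightarrow> 'a \<Rightarrow>\<^sub>L 'a) \<Rightarrow> (real \<Rightarrow> 'a \<Rightarrow>\<^sub>L 'a) \<Rightarrow> bool" where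
  "C1_path_in P T \<eta> \<eta>dot \<longleftrightarrow>
     (\<forall>t\<in>{0..T}. \<eta> t \<in> P) \<and>
     (\<forall>t\<in>{0..T}. (\<eta> has_vector_derivative \<eta>dot t) (at t within {0..T})) \<and>
     continuous_on {0..T} \<eta>dot"

text \<open>
  For a positive map \<open>\<eta>\<close>, these conditions determine the values of \<open>G\<close> on the upper half-plane;
  its values elsewhere are arbitrary.
\<close>

definition dyson_solution ::
    "('a::unital_cstar_algebra \<Rightarrow>\<^sub>L 'a) \<Rightarrow> ('a \<Rightarrow> 'a) \<Rightarrow> bool" where
  "dyson_solution \<eta> G \<longleftrightarrow>
     (\<forall>b\<in>upper_half. G b \<in> lower_half \<and> b * G b = 1 + \<eta> (G b) * G b)"

definition has_complex_frechet_derivative ::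
    "('a::unital_cstar_algebra \<Rightarrow> 'a) \<Rightarrow> ('a \<Rightarrow> 'a) \<Rightarrow> 'a \<Rightarrow> bool" where
  "has_complex_frechet_derivative f D b \<longleftrightarrow> (f has_derivative D) (at b) \<and> complex_linear D"

text \<open>Used for open sets only.\<close>

definition cstar_holomorphic_on ::
    "('a::unital_cstar_algebra \<Rightarrow> 'a) \<Rightarrow> 'a set \<Rightarrow> bool" where
  "cstar_holomorphic_on f S \<longleftrightarrow> (\<forall>b\<in>S. \<exists>D. has_complex_frechet_derivative f D b)"

end

theory Submission
  imports Defs
begin

text \<open>
  The function \<open>G\<^sub>t(b) = g\<close> solves \<open>w g = 1\<close> with \<open>w = b - \<eta>\<^sub>t(g)\<close>, and \<open>w\<close> has imaginary part at
  least \<open>\<gamma>\<close> when \<open>b\<close> has. Everything rests on a bound for the linearised equation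
  \<open>w d w - \<eta>(d) = h\<close> that is uniform on closed half-planes, namely
  \<open>norm d \<le> norm h / \<gamma>\<^sup>2\<close> (\<open>dyson_linearisation_bounded_below\<close>); in fact the bound holds for
  \<open>w\<^sub>1 d w\<^sub>2 - \<eta>(d)\<close> with two solutions.

  For the bound, put \<open>v\<^sub>i = - Im g\<^sub>i\<close>. Taking imaginary parts in the equation shows that
  \<open>v\<^sub>1 = g\<^sub>1 (Im b\<^sub>1) g\<^sub>1\<^sup>* + g\<^sub>1 \<eta>(v\<^sub>1) g\<^sub>1\<^sup>*\<close>, and similarly for \<open>v\<^sub>2\<close>. So \<open>v\<^sub>1\<close> and \<open>v\<^sub>2\<close> are
  strictly contracted by the corresponding positive maps. Measure \<open>d\<close> by the least \<open>c\<close> for which the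
  block with diagonal \<open>c v\<^sub>1, c v\<^sub>2\<close> and corner \<open>d\<close> is positive. Because \<open>\<eta>\<close> is \<open>2\<close>-positive, it maps
  positive blocks to positive blocks, and \<open>d \<mapsto> g\<^sub>1 \<eta>(d) g\<^sub>2\<close> becomes a contraction in this measure
  (\<open>dyson_step\<close>). The rate depends on \<open>b\<close>, but the inhomogeneity \<open>g\<^sub>1 h g\<^sub>2\<close> is dominated by the
  defects \<open>g\<^sub>i (Im b\<^sub>i) g\<^sub>i\<^sup>*\<close> themselves, and in the resulting estimate the rate cancels.

  The bound gives Lipschitz continuity in \<open>b\<close>, hence uniqueness, and a first-order expansion with a
  quadratic remainder that is uniform on closed half-planes (\<open>dyson_expansion\<close>); the derivative
  \<open>DG\<^sub>t(b)\<close> is the negative of the inverse of \<open>d \<mapsto> w d w - \<eta>(d)\<close>. Variation of \<open>t\<close> is reduced to variation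
  of \<open>b\<close>: since \<open>G\<^sub>s(b)\<close> satisfies the equation of \<open>\<eta>\<^sub>t\<close> at a shifted point,
  \<open>G\<^sub>s(b) = G\<^sub>t(b - (\<eta>\<^sub>s - \<eta>\<^sub>t)(G\<^sub>s(b)))\<close> (\<open>solution_change_operator\<close>). With the expansion at time \<open>t\<close>
  this gives the differential equation, uniformly in \<open>b\<close>. Continuity and holomorphy of the
  time derivative hold because it is obtained by inverting operators that are uniformly bounded below
  and depend continuously and holomorphically on the parameters.

  The facts on C*-algebras that enter (sums of positive elements are positive, the norm is monotone,
  \<open>x\<^sup>* x\<close> is a square of a selfadjoint element) are derived from convergent square roots.
\<close>

section \<open>Elementary properties of the involution\<close>

interpretation cvec: vector_space "scaleC :: complex \<Rightarrow> 'a::unital_cstar_algebra \<Rightarrow> 'a"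
  by unfold_locales (simp_all add: scaleC_add_right scaleC_add_left scaleC_scaleC scaleC_one)

lemma star_zero [simp]: "star 0 = (0::'a::unital_cstar_algebra)"
  using star_add[of 0 "0::'a"] by simp

lemma star_minus [simp]: "star (- x) = - star (x::'a::unital_cstar_algebra)"
  using star_add[of x "- x"] by (simp add: minus_unique)

lemma star_diff: "star (x - y) = star x - star (y::'a::unital_cstar_algebra)"
  using star_add[of x "- y"] by simp

lemma star_one [simp]: "star 1 = (1::'a::unital_cstar_algebra)"
  by (metis mult.right_neutral star_mult star_star)

lemma star_scaleR [simp]: "star (r *\<^sub>R x) = r *\<^sub>R star (x::'a::unital_cstar_algebra)"
  by (simp add: scaleR_scaleC star_scaleC)

lemma norm_star [simp]: "norm (star x) = norm (x::'a::unital_cstar_algebra)"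
proof -
  have le: "norm y \<le> norm (star y)" for y :: 'a
  proof (cases "y = 0")
    case False
    have "norm y * norm y \<le> norm (star y) * norm y"
      using norm_star_mult_self[of y] norm_mult_ineq[of "star y" y] by (simp add: power2_eq_square)
    with False show ?thesis by simp
  qed simp
  show ?thesis using le[of x] le[of "star x"] by (simp add: star_star)
qed

lemma bounded_linear_star: "bounded_linear (star :: 'a::unital_cstar_algebra \<Rightarrow> 'a)"
  by (rule bounded_linear_intro[where K = 1]) (simp_all add: star_add)

lemma norm_selfadjoint_square:
  assumes "star h = (h::'a::unital_cstar_algebra)"
  shows "norm (h * h) = (norm h)\<^sup>2"
  using norm_star_mult_self[of h] assms by simp

section \<open>Square roots\<close>

text \<open>
  The iteration converges to \<open>1 - sqrt (1 - z)\<close>. All its terms are polynomials in \<open>z\<close> with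
  nonnegative coefficients, so in norm it is dominated by the scalar iteration with \<open>z = 1\<close>,
  which is increasing and bounded by \<open>1\<close>. The domination includes the boundary case \<open>norm z = 1\<close>.
\<close>

primrec sqrt_iter :: "'a::real_normed_algebra_1 \<Rightarrow> nat \<Rightarrow> 'a" where
  "sqrt_iter z 0 = 0"
| "sqrt_iter z (Suc n) = (1 / 2) *\<^sub>R (z + sqrt_iter z n * sqrt_iter z n)"

lemma sqrt_iter_scalar_bounds: "0 \<le> sqrt_iter (1::real) n \<and> sqrt_iter (1::real) n \<le> 1"
proof (induction n)
  case (Suc n)
  then have "sqrt_iter (1::real) n * sqrt_iter 1 n \<le> 1 * 1"
    by (intro mult_mono) auto
  with Suc show ?case by simp
qed simp

lemma norm_sqrt_iter_le:
  assumes "norm z \<le> 1"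
  shows "norm (sqrt_iter z n) \<le> sqrt_iter (1::real) n"
proof (induction n)
  case (Suc n)
  have "norm (z + sqrt_iter z n * sqrt_iter z n) \<le> norm z + norm (sqrt_iter z n) * norm (sqrt_iter z n)"
    by (meson add_left_mono norm_mult_ineq norm_triangle_le)
  also have "\<dots> \<le> 1 + sqrt_iter (1::real) n * sqrt_iter 1 n"
    by (intro add_mono mult_mono assms Suc) (use sqrt_iter_scalar_bounds in auto)
  finally show ?case by simp
qed simp

lemma norm_sqrt_iter_diff_le:
  assumes "norm z \<le> 1"
  shows "norm (sqrt_iter z (Suc n) - sqrt_iter z n) \<le> sqrt_iter (1::real) (Suc n) - sqrt_iter 1 n"
proof (induction n)
  case (Suc n)
  let ?u = "sqrt_iter z" and ?c = "sqrt_iter (1::real)"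
  have eq: "?u (Suc (Suc n)) - ?u (Suc n) =
      (1/2) *\<^sub>R (?u (Suc n) * (?u (Suc n) - ?u n) + (?u (Suc n) - ?u n) * ?u n)"
    unfolding sqrt_iter.simps(2)[of z "Suc n"]
    by (subst (3) sqrt_iter.simps(2)) (simp add: algebra_simps del: sqrt_iter.simps)
  have "norm (?u (Suc n) * (?u (Suc n) - ?u n) + (?u (Suc n) - ?u n) * ?u n)
      \<le> norm (?u (Suc n)) * norm (?u (Suc n) - ?u n) + norm (?u (Suc n) - ?u n) * norm (?u n)"
    by (meson add_mono norm_mult_ineq norm_triangle_le)
  also have "\<dots> \<le> ?c (Suc n) * (?c (Suc n) - ?c n) + (?c (Suc n) - ?c n) * ?c n"
    by (intro add_mono mult_mono Suc norm_sqrt_iter_le assms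
        order_trans[OF norm_ge_zero Suc] norm_ge_zero)
      (use sqrt_iter_scalar_bounds in blast)
  also have "\<dots> = 2 * (?c (Suc (Suc n)) - ?c (Suc n))"
    unfolding sqrt_iter.simps(2)[of 1 "Suc n"]
    by (subst (5) sqrt_iter.simps(2)) (simp add: algebra_simps del: sqrt_iter.simps)
  finally show ?case unfolding eq by (simp del: sqrt_iter.simps)
qed (simp add: assms)

lemma convergent_sqrt_iter:
  fixes z :: "'a::{real_normed_algebra_1, banach}"
  assumes "norm z \<le> 1"
  shows "convergent (sqrt_iter z)"
proof -
  let ?c = "sqrt_iter (1::real)"
  have mono: "incseq ?c"
    unfolding incseq_Suc_iff
    using norm_sqrt_iter_diff_le[of "1::real"] by (metis diff_ge_0_iff_ge norm_ge_zero norm_one order_refl order_trans)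
  then obtain l where "?c \<longlonglongrightarrow> l"
    using incseq_convergent[OF mono, of 1] sqrt_iter_scalar_bounds by blast
  then have "summable (\<lambda>n. ?c (Suc n) - ?c n)"
    by (rule telescope_summable)
  then have "summable (\<lambda>n. sqrt_iter z (Suc n) - sqrt_iter z n)"
    by (rule summable_comparison_test') (rule norm_sqrt_iter_diff_le[OF assms])
  then have "convergent (\<lambda>n. \<Sum>k<n. sqrt_iter z (Suc k) - sqrt_iter z k)"
    by (simp only: summable_iff_convergent)
  then show ?thesis by (simp add: sum_lessThan_telescope del: sqrt_iter.simps(2))
qed

lemma sqrt_exists:
  fixes z :: "'a::unital_cstar_algebra"
  assumes z: "norm z \<le> 1" "star z = z"
  obtains u where "norm u \<le> 1" "star u = u" "(1 - u) * (1 - u) = 1 - z"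
    "\<And>y. y * z = z * y \<Longrightarrow> y * u = u * y"
proof -
  obtain u where lim: "sqrt_iter z \<longlonglongrightarrow> u"
    using convergent_sqrt_iter[OF z(1)] by (auto simp: convergent_def)
  have "norm u \<le> 1"
    by (rule LIMSEQ_le_const2[OF tendsto_norm[OF lim]])
      (meson norm_sqrt_iter_le[OF z(1)] sqrt_iter_scalar_bounds order_trans)
  moreover have "star u = u"
  proof (rule LIMSEQ_unique[OF _ lim])
    have "star (sqrt_iter z n) = sqrt_iter z n" for n
      by (induction n) (simp_all add: star_add star_mult z)
    then show "sqrt_iter z \<longlonglongrightarrow> star u"
      using bounded_linear.tendsto[OF bounded_linear_star lim] by simp
  qed
  moreover have "(1 - u) * (1 - u) = 1 - z"
  proof -
    have "(\<lambda>n. sqrt_iter z (Suc n)) \<longlonglongrightarrow> (1/2) *\<^sub>R (z + u * u)"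
      unfolding sqrt_iter.simps by (intro tendsto_intros lim)
    then have "u = (1/2) *\<^sub>R (z + u * u)"
      using LIMSEQ_unique LIMSEQ_Suc[OF lim] by blast
    then have "2 *\<^sub>R u = z + u * u"
      by (metis (no_types, lifting) divide_self_if scaleR_scaleR mult.commute
          scaleR_one times_divide_eq_left zero_neq_numeral mult_1)
    then show ?thesis by (simp add: algebra_simps scaleR_2)
  qed
  moreover have "y * u = u * y" if "y * z = z * y" for y
  proof (rule LIMSEQ_unique)
    have "y * sqrt_iter z n = sqrt_iter z n * y" for n
      by (induction n) (simp_all add: distrib_left distrib_right that, metis mult.assoc)
    then show "(\<lambda>n. sqrt_iter z n * y) \<longlonglongrightarrow> y * u"
      using tendsto_mult[OF tendsto_const lim, of y] by simp
    show "(\<lambda>n. sqrt_iter z n * y) \<longlonglongrightarrow> u * y"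
      by (intro tendsto_intros lim)
  qed
  ultimately show ?thesis by (rule that)
qed

section \<open>The positive cone\<close>

text \<open>
  In terms of spectra: the disc of radius \<open>t\<close> around \<open>t\<close> meets the real axis in nonnegative numbers
  only. Unlike \<^const>\<open>cstar_positive\<close>, with which it turns out to agree, this description makes
  sums of positive elements positive by the triangle inequality.
\<close>

definition metric_positive :: "'a::unital_cstar_algebra \<Rightarrow> bool" where
  "metric_positive h \<longleftrightarrow> star h = h \<and> (\<exists>t. norm (t *\<^sub>R 1 - h) \<le> t)"

lemma metric_positive_zero [simp]: "metric_positive 0"
  by (auto simp: metric_positive_def intro!: exI[of _ 0])

lemma metric_positive_add:
  assumes "metric_positive h" "metric_positive k"
  shows "metric_positive (h + k)"
proof -
  obtain s t where st: "norm (s *\<^sub>R 1 - h) \<le> s" "norm (t *\<^sub>R 1 - k) \<le> t"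
    using assms by (auto simp: metric_positive_def)
  have "norm ((s + t) *\<^sub>R 1 - (h + k)) \<le> norm (s *\<^sub>R 1 - h) + norm (t *\<^sub>R 1 - k)"
    by (rule order_trans[OF _ norm_triangle_ineq]) (simp add: algebra_simps)
  then show ?thesis
    using assms st unfolding metric_positive_def
    by (intro conjI exI[of _ "s + t"]) (auto simp: star_add)
qed

lemma metric_positive_scaleR:
  assumes "metric_positive h" "0 \<le> r"
  shows "metric_positive (r *\<^sub>R h)"
proof -
  obtain t where t: "norm (t *\<^sub>R 1 - h) \<le> t"
    using assms by (auto simp: metric_positive_def)
  have "norm ((r * t) *\<^sub>R 1 - r *\<^sub>R h) = r * norm (t *\<^sub>R 1 - h)"
    using assms(2) by (simp flip: scaleR_scaleR scaleR_diff_right)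
  then show ?thesis
    using assms mult_left_mono[OF t assms(2)] unfolding metric_positive_def
    by (intro conjI exI[of _ "r * t"]) auto
qed

lemma metric_positive_norm_bound:
  assumes "star h = h" "norm h \<le> r"
  shows "metric_positive (r *\<^sub>R 1 - h)" "metric_positive (r *\<^sub>R 1 + h)"
  using assms unfolding metric_positive_def
  by (auto simp: star_diff star_add intro!: exI[of _ r])

lemma metric_positive_sqrt:
  assumes "metric_positive h"
  obtains s where "star s = s" "s * s = h" "metric_positive s"
    "\<And>y. y * h = h * y \<Longrightarrow> y * s = s * y"
proof -
  obtain t where t: "norm (t *\<^sub>R 1 - h) \<le> t" and h: "star h = h"
    using assms by (auto simp: metric_positive_def)
  have "0 \<le> t" using t norm_ge_zero order_trans by blast
  \<comment> \<open>For \<open>t > 0\<close>, the element is \<open>t (1 - z)\<close> with \<open>norm z \<le> 1\<close>.\<close>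
  show ?thesis
  proof (cases "t = 0")
    case True
    then have "h = 0" using t by simp
    then show ?thesis using that[of 0] by simp
  next
    case False
    with \<open>0 \<le> t\<close> have "t > 0" by simp
    define z where "z = 1 - (1 / t) *\<^sub>R h"
    have "z = (1 / t) *\<^sub>R (t *\<^sub>R 1 - h)"
      using \<open>t > 0\<close> by (simp add: z_def scaleR_diff_right)
    then have "norm z \<le> 1"
      using t \<open>t > 0\<close> by simp
    moreover have "star z = z" by (simp add: z_def star_diff h)
    ultimately obtain u where u: "norm u \<le> 1" "star u = u" "(1 - u) * (1 - u) = 1 - z"
      and comm: "\<And>y. y * z = z * y \<Longrightarrow> y * u = u * y"
      by (rule sqrt_exists) blast
    show ?thesis
    proof (rule that)
      let ?s = "sqrt t *\<^sub>R (1 - u)"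
      show "star ?s = ?s" by (simp add: star_diff u)
      have "?s * ?s = t *\<^sub>R ((1 - u) * (1 - u))"
        using \<open>t > 0\<close> by simp
      also have "\<dots> = h" using \<open>t > 0\<close> by (simp add: u z_def)
      finally show "?s * ?s = h" .
      show "metric_positive ?s"
        using \<open>t > 0\<close> metric_positive_norm_bound(1)[OF u(2,1)] by (intro metric_positive_scaleR) simp_all
      show "y * ?s = ?s * y" if "y * h = h * y" for y
        using comm[of y] that by (simp add: z_def algebra_simps)
    qed
  qed
qed

text \<open>
  If commuting selfadjoint elements satisfy \<open>s\<^sup>2 + r\<^sup>2 = m\<close>, then \<open>s + \<i> r\<close> is
  \<open>sqrt m\<close> times a unitary. This bounds its norm and that of its square, and hence their real
  parts \<open>s\<close> and \<open>s\<^sup>2 - r\<^sup>2\<close>. The two bounds do the work of the spectral theorem in what follows.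
\<close>

lemma circle_bounds:
  fixes s r :: "'a::unital_cstar_algebra"
  assumes "star s = s" "star r = r" "s * r = r * s" "s * s + r * r = m *\<^sub>R 1" "0 \<le> m"
  shows "(norm s)\<^sup>2 \<le> m" "norm (r * r) \<le> m"
proof -
  define u where "u = s + \<i> *\<^sub>C r"
  have su: "star u = s - \<i> *\<^sub>C r"
    by (simp add: u_def star_add star_scaleC assms cvec.scale_minus_left)
  have "star u * u = m *\<^sub>R 1"
    unfolding su unfolding u_def
    by (simp add: algebra_simps mult_scaleC_left mult_scaleC_right scaleC_scaleC scaleC_one
        cvec.scale_minus_left assms(3) assms(4)[symmetric])
  then have nu: "(norm u)\<^sup>2 = m"
    using norm_star_mult_self[of u] assms(5) by simp
  have "2 *\<^sub>R s = u + star u"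
    unfolding su by (simp add: u_def scaleR_2)
  then have "norm (2 *\<^sub>R s) \<le> norm u + norm u"
    using norm_triangle_ineq[of u "star u"] by simp
  then show "(norm s)\<^sup>2 \<le> m"
    using nu power_mono[of "norm s" "norm u" 2] by simp
  have two: "(\<i> * 2) *\<^sub>C x = \<i> *\<^sub>C x + \<i> *\<^sub>C x" for x :: 'a
    by (simp only: mult_2_right scaleC_add_left)
  have "u * u = s * s - r * r + (2 * \<i>) *\<^sub>C (s * r)" "star u * star u = s * s - r * r - (2 * \<i>) *\<^sub>C (s * r)"
    unfolding su unfolding u_def
    by (simp_all add: algebra_simps mult_scaleC_left mult_scaleC_right scaleC_scaleC scaleC_one
        cvec.scale_minus_left assms(3) two)
  moreover have "(2 * m) *\<^sub>R 1 = 2 *\<^sub>R (s * s) + 2 *\<^sub>R (r * r)"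
    by (metis assms(4) scaleR_add_right scaleR_scaleR)
  moreover have "4 *\<^sub>R (r * r) = 2 *\<^sub>R (r * r) + 2 *\<^sub>R (r * r)"
    by (simp flip: scaleR_left_distrib)
  ultimately have "4 *\<^sub>R (r * r) = (2 * m) *\<^sub>R 1 - u * u - star u * star u"
    by (simp add: scaleR_2)
  then have "4 * norm (r * r) \<le> norm ((2 * m) *\<^sub>R 1 :: 'a) + norm (u * u) + norm (star u * star u)"
    using norm_triangle_ineq4[of "(2 * m) *\<^sub>R 1 - u * u" "star u * star u"]
      norm_triangle_ineq4[of "(2 * m) *\<^sub>R (1::'a)" "u * u"]
    by (metis (no_types, lifting) abs_numeral add.commute add_left_mono norm_scaleR order_trans)
  moreover have "norm (u * u) \<le> m" "norm (star u * star u) \<le> m"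
    using norm_mult_ineq[of u u] norm_mult_ineq[of "star u" "star u"] nu by (simp_all add: power2_eq_square)
  ultimately show "norm (r * r) \<le> m"
    using assms(5) by simp
qed

text \<open>
  The square \<open>h * h\<close> lies in the ball of radius \<open>m = (norm h)\<^sup>2\<close> around \<open>m\<close>, because
  \<open>m - h * h = r * r\<close> for an \<open>r\<close> commuting with \<open>h\<close>.
\<close>

lemma metric_positive_square:
  assumes h: "star h = (h::'a::unital_cstar_algebra)"
  shows "metric_positive (h * h)"
proof -
  define m where "m = (norm h)\<^sup>2"
  have hh: "star (h * h) = h * h" by (simp add: star_mult h)
  have "metric_positive (m *\<^sub>R 1 - h * h)"
    by (rule metric_positive_norm_bound(1)[OF hh]) (simp add: m_def norm_selfadjoint_square h)
  then obtain r where r: "star r = r" "r * r = m *\<^sub>R 1 - h * h"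
    and comm: "\<And>y. y * (m *\<^sub>R 1 - h * h) = (m *\<^sub>R 1 - h * h) * y \<Longrightarrow> y * r = r * y"
    using metric_positive_sqrt by metis
  have "h * r = r * h" by (rule comm) (simp add: algebra_simps)
  with r have "norm (r * r) \<le> m"
    by (intro circle_bounds(2)[of h]) (auto simp: h m_def)
  then show ?thesis
    using hh r(2) unfolding metric_positive_def by auto
qed

lemma metric_positive_norm_mono:
  assumes h: "metric_positive h" and k: "metric_positive (r *\<^sub>R 1 - h)" and "0 \<le> r"
  shows "norm h \<le> r"
proof -
  obtain s where s: "star s = s" "s * s = h"
    using metric_positive_sqrt[OF h] by metis
  obtain q where q: "star q = q" "q * q = r *\<^sub>R 1 - h"
    and comm: "\<And>y. y * (r *\<^sub>R 1 - h) = (r *\<^sub>R 1 - h) * y \<Longrightarrow> y * q = q * y"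
    using metric_positive_sqrt[OF k] by metis
  have "s * q = q * s"
    by (rule comm) (simp add: algebra_simps flip: s(2))
  then have "(norm s)\<^sup>2 \<le> r"
    using \<open>0 \<le> r\<close> by (intro circle_bounds(1)[of s q]) (auto simp: s q)
  then show ?thesis
    using norm_selfadjoint_square[OF s(1)] s(2) by simp
qed

text \<open>
  The step from \<open>x * x\<close> with \<open>x\<close> selfadjoint to \<open>star y * y\<close>. If \<open>- star y * y\<close> is
  positive, then so is \<open>p = y * star y\<close>, because the sum of \<open>star y * y\<close> and \<open>y * star y\<close>
  is a sum of selfadjoint squares. Put \<open>t = norm p\<close>. Then
  \<open>y * (t + star y * y) * star y = t p + p\<^sup>2\<close> has norm at most \<open>t\<^sup>2\<close>, although it
  dominates \<open>2 p\<^sup>2\<close>, of norm \<open>2 t\<^sup>2\<close>, since \<open>p\<^sup>2\<close> is at most \<open>t p\<close>. So \<open>t = 0\<close>.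
\<close>

lemma negative_star_mult_self_eq_zero:
  fixes y :: "'a::unital_cstar_algebra"
  assumes neg: "metric_positive (- (star y * y))"
  shows "y = 0"
proof -
  define p where "p = y * star y"
  define t where "t = (norm y)\<^sup>2"
  have sp: "star p = p" by (simp add: p_def star_mult star_star)
  have np: "norm p = t"
    using norm_star_mult_self[of "star y"] by (simp add: p_def t_def star_star)
  have "metric_positive p"
  proof -
    define a where "a = (1/2) *\<^sub>R (y + star y)"
    define b where "b = (\<i> / 2) *\<^sub>C (star y - y)"
    have "star a = a" "star b = b"
      by (simp_all add: a_def b_def star_add star_star star_scaleC star_diff add.commute
          cvec.scale_right_diff_distrib cvec.scale_minus_left)
    moreover have "star y * y + p = 2 *\<^sub>R (a * a) + 2 *\<^sub>R (b * b)"
    proof -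
      have 1: "4 *\<^sub>R (a * a) = (y + star y) * (y + star y)"
        by (simp add: a_def)
      have "(4::complex) *\<^sub>C (b * b) = (- 1) *\<^sub>C ((star y - y) * (star y - y))"
        by (simp add: b_def mult_scaleC_left mult_scaleC_right scaleC_scaleC)
      then have 2: "4 *\<^sub>R (b * b) = - ((star y - y) * (star y - y))"
        by (simp add: scaleR_scaleC cvec.scale_minus_left scaleC_one)
      have "2 *\<^sub>R (star y * y + p) = 4 *\<^sub>R (a * a) + 4 *\<^sub>R (b * b)"
        unfolding 1 2 by (simp add: p_def algebra_simps scaleR_2)
      also have "\<dots> = 2 *\<^sub>R (2 *\<^sub>R (a * a) + 2 *\<^sub>R (b * b))"
        by (simp add: scaleR_add_right)
      finally show ?thesis by (simp only: scaleR_cancel_left) simp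
    qed
    ultimately have "metric_positive (star y * y + p)"
      by (simp add: metric_positive_add metric_positive_scaleR metric_positive_square)
    from metric_positive_add[OF this neg] show ?thesis by simp
  qed
  then obtain s where s: "star s = s" "s * s = p"
    by (rule metric_positive_sqrt)
  have "metric_positive (t *\<^sub>R 1 - p)"
    by (rule metric_positive_norm_bound) (simp_all add: sp np)
  then obtain r where r: "star r = r" "r * r = t *\<^sub>R 1 - p"
    and comm: "\<And>y. y * (t *\<^sub>R 1 - p) = (t *\<^sub>R 1 - p) * y \<Longrightarrow> y * r = r * y"
    using metric_positive_sqrt by metis
  have sr: "s * r = r * s"
    by (rule comm) (simp add: algebra_simps flip: s(2))
  have mp: "metric_positive (t *\<^sub>R p - p * p)"
  proof -
    have "s * r * (s * r) = r * (s * s) * r" using sr by (metis mult.assoc)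
    also have "\<dots> = p * (r * r)"
      unfolding s by (metis mult.assoc s(2) sr)
    also have "\<dots> = t *\<^sub>R p - p * p" by (simp add: r algebra_simps)
    finally show ?thesis using metric_positive_square[of "s * r"]
      by (simp add: star_mult s r sr)
  qed
  have "norm (t *\<^sub>R 1 - - (star y * y)) \<le> t"
  proof -
    obtain q where q: "star q = q" "q * q = - (star y * y)"
      using metric_positive_sqrt[OF neg] by metis
    define m where "m = (norm q)\<^sup>2"
    have tm: "m = t" unfolding m_def t_def
      using norm_selfadjoint_square[OF q(1)] q(2) norm_star_mult_self[of y] by simp
    have "metric_positive (t *\<^sub>R 1 - q * q)"
      by (rule metric_positive_norm_bound)
        (auto simp: star_mult q(1) norm_selfadjoint_square tm[symmetric] m_def)
    moreover have "metric_positive (t *\<^sub>R 1 - (t *\<^sub>R 1 - q * q))"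
      using metric_positive_square[OF q(1)] by simp
    ultimately have "norm (t *\<^sub>R 1 - q * q) \<le> t"
      by (rule metric_positive_norm_mono) (simp add: t_def)
    then show ?thesis by (simp add: q)
  qed
  then have "norm (y * (t *\<^sub>R 1 + star y * y) * star y) \<le> norm y * t * norm y"
    by (intro order_trans[OF norm_mult_ineq] mult_mono order_trans[OF norm_mult_ineq])
      (auto simp: t_def)
  moreover have "y * (t *\<^sub>R 1 + star y * y) * star y = t *\<^sub>R p + p * p"
    by (simp add: p_def algebra_simps mult.assoc)
  ultimately have up: "norm (t *\<^sub>R p + p * p) \<le> t * t"
    by (simp add: t_def power2_eq_square mult.commute mult.left_commute)
  have "metric_positive (2 *\<^sub>R (p * p))"
    by (simp add: metric_positive_scaleR metric_positive_square sp)
  moreover have "metric_positive ((t * t) *\<^sub>R 1 - 2 *\<^sub>R (p * p))"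
  proof -
    have "metric_positive ((t * t) *\<^sub>R 1 - (t *\<^sub>R p + p * p))"
      by (rule metric_positive_norm_bound[OF _ up]) (simp add: star_add star_mult sp)
    from metric_positive_add[OF this mp] show ?thesis by (simp add: scaleR_2 algebra_simps)
  qed
  ultimately have "norm (2 *\<^sub>R (p * p)) \<le> t * t"
    by (rule metric_positive_norm_mono) simp
  then have "2 * t\<^sup>2 \<le> t\<^sup>2"
    by (simp add: norm_selfadjoint_square sp np power2_eq_square)
  then show ?thesis by (simp add: t_def)
qed

text \<open>
  For \<open>h = star x * x\<close> with modulus \<open>a = sqrt (h\<^sup>2)\<close>, the element \<open>b = a - h\<close> is twice
  the negative part of \<open>h\<close>. It satisfies \<open>a b = - h b\<close>, hence \<open>star (x b) * (x b) = - b a b\<close>, so the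
  preceding lemma forces \<open>x b = 0\<close>, and then \<open>b = 0\<close>.
\<close>

lemma metric_positive_star_mult_self: "metric_positive (star x * (x::'a::unital_cstar_algebra))"
proof -
  define h where "h = star x * x"
  have sh: "star h = h" by (simp add: h_def star_mult star_star)
  obtain a where a: "star a = a" "a * a = h * h" "metric_positive a"
    and "\<And>y. y * (h * h) = (h * h) * y \<Longrightarrow> y * a = a * y"
    using metric_positive_sqrt[OF metric_positive_square[OF sh]] by metis
  then have ha: "h * a = a * h" by (simp add: mult.assoc)
  obtain r where r: "star r = r" "r * r = a"
    and comm: "\<And>y. y * a = a * y \<Longrightarrow> y * r = r * y"
    using metric_positive_sqrt[OF a(3)] by metis
  define b where "b = a - h"
  have sb: "star b = b" by (simp add: b_def star_diff a sh)
  have br: "b * r = r * b" by (rule comm) (simp add: b_def algebra_simps ha)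
  have ab: "a * b = - (h * b)" by (simp add: b_def algebra_simps a ha)
  have eq: "star (x * b) * (x * b) = - ((b * r) * (b * r))"
  proof -
    have "star (x * b) * (x * b) = b * (h * b)"
      by (simp add: star_mult sb h_def mult.assoc)
    also have "\<dots> = - (b * (a * b))" by (simp add: ab)
    also have "b * (a * b) = b * r * (b * r)"
      using br by (metis mult.assoc r(2))
    finally show ?thesis .
  qed
  then have "metric_positive (- (star (x * b) * (x * b)))"
    using metric_positive_square[of "b * r"] by (simp add: star_mult sb r br)
  then have "x * b = 0"
    by (rule negative_star_mult_self_eq_zero)
  then have hb: "h * b = 0" by (simp add: h_def mult.assoc)
  with ab have "a * b = 0" by simp
  with hb have "b * b = 0" by (simp add: left_diff_distrib[of a h b, folded b_def])
  then have "b = 0"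
    using norm_selfadjoint_square[OF sb] by simp
  then show ?thesis using a(3) by (simp add: b_def h_def)
qed

lemma cstar_positive_iff_metric: "cstar_positive h \<longleftrightarrow> metric_positive (h::'a::unital_cstar_algebra)"
  unfolding cstar_positive_def
  by (metis metric_positive_sqrt metric_positive_star_mult_self)

section \<open>The order\<close>

notation cstar_le (infix "\<sqsubseteq>" 50)

lemma cstar_positive_star: "cstar_positive h \<Longrightarrow> star h = h"
  by (auto simp: cstar_positive_def star_mult star_star)

lemma cstar_positive_zero [simp]: "cstar_positive 0"
  by (simp add: cstar_positive_iff_metric)

lemma cstar_positive_one [simp]: "cstar_positive 1"
  unfolding cstar_positive_def by (rule exI[of _ 1]) simp

lemma cstar_positive_add: "cstar_positive h \<Longrightarrow> cstar_positive k \<Longrightarrow> cstar_positive (h + k)"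
  by (simp add: cstar_positive_iff_metric metric_positive_add)

lemma cstar_positive_scaleR: "cstar_positive h \<Longrightarrow> 0 \<le> r \<Longrightarrow> cstar_positive (r *\<^sub>R h)"
  by (simp add: cstar_positive_iff_metric metric_positive_scaleR)

lemma cstar_positive_star_mult_self [simp]: "cstar_positive (star x * x)"
  by (auto simp: cstar_positive_def)

lemma cstar_positive_congruence:
  assumes "cstar_positive h"
  shows "cstar_positive (star x * h * x)"
proof -
  obtain y where "h = star y * y" using assms by (auto simp: cstar_positive_def)
  then have "star x * h * x = star (y * x) * (y * x)" by (simp add: star_mult mult.assoc)
  then show ?thesis by simp
qed

lemma cstar_le_refl [simp]: "a \<sqsubseteq> a"
  by (simp add: cstar_le_def)

lemma cstar_le_trans [trans]: "a \<sqsubseteq> b \<Longrightarrow> b \<sqsubseteq> c \<Longrightarrow> a \<sqsubseteq> c"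
  using cstar_positive_add[of "b - a" "c - b"] by (simp add: cstar_le_def)

lemma cstar_le_add: "a \<sqsubseteq> b \<Longrightarrow> c \<sqsubseteq> d \<Longrightarrow> a + c \<sqsubseteq> b + d"
  using cstar_positive_add[of "b - a" "d - c"] by (simp add: cstar_le_def algebra_simps)

lemma cstar_le_scaleR: "a \<sqsubseteq> b \<Longrightarrow> 0 \<le> r \<Longrightarrow> r *\<^sub>R a \<sqsubseteq> r *\<^sub>R b"
  using cstar_positive_scaleR[of "b - a" r] by (simp add: cstar_le_def scaleR_diff_right)

lemma cstar_le_scaleR_left: "cstar_positive a \<Longrightarrow> r \<le> s \<Longrightarrow> r *\<^sub>R a \<sqsubseteq> s *\<^sub>R a"
  using cstar_positive_scaleR[of a "s - r"] by (simp add: cstar_le_def scaleR_diff_left)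

lemma cstar_positive_mono: "cstar_positive a \<Longrightarrow> a \<sqsubseteq> b \<Longrightarrow> cstar_positive b"
  using cstar_positive_add[of a "b - a"] by (simp add: cstar_le_def)

lemma cstar_le_congruence: "a \<sqsubseteq> b \<Longrightarrow> star x * a * x \<sqsubseteq> star x * b * x"
  using cstar_positive_congruence[of "b - a" x] by (simp add: cstar_le_def algebra_simps)

lemma cstar_le_norm:
  assumes "star h = h" "norm h \<le> r"
  shows "h \<sqsubseteq> r *\<^sub>R 1" "- (r *\<^sub>R 1) \<sqsubseteq> h"
  using metric_positive_norm_bound[OF assms]
  by (simp_all add: cstar_le_def cstar_positive_iff_metric add.commute)

lemma norm_le_of_cstar_le:
  "cstar_positive h \<Longrightarrow> h \<sqsubseteq> r *\<^sub>R 1 \<Longrightarrow> 0 \<le> r \<Longrightarrow> norm h \<le> r"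
  by (simp add: cstar_le_def cstar_positive_iff_metric metric_positive_norm_mono)

lemma norm_mono_cstar_le:
  assumes "cstar_positive h" "h \<sqsubseteq> k"
  shows "norm h \<le> norm k"
  using assms cstar_le_norm(1)[of k "norm k"] cstar_positive_star[OF cstar_positive_mono[OF assms]]
  by (intro norm_le_of_cstar_le) (auto intro: cstar_le_trans)

lemma one_minus_invertible:
  fixes z :: "'a::{real_normed_algebra_1, banach}"
  assumes "norm z < 1"
  obtains k where "k * (1 - z) = 1" "(1 - z) * k = 1"
proof -
  have sm: "summable (\<lambda>n. z ^ n)"
    using assms by (rule complete_algebra_summable_geometric)
  have "(\<lambda>n. z ^ n) \<longlonglongrightarrow> 0"
    using sm by (rule summable_LIMSEQ_zero)
  then have tel: "(\<lambda>n. z ^ n - z ^ Suc n) sums 1"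
    using telescope_sums' by fastforce
  show ?thesis
  proof (rule that)
    have "(\<lambda>n. z ^ n * (1 - z)) sums ((\<Sum>n. z ^ n) * (1 - z))"
      by (intro sums_mult2 summable_sums sm)
    moreover have "(\<lambda>n. z ^ n * (1 - z)) = (\<lambda>n. z ^ n - z ^ Suc n)"
      by (simp add: right_diff_distrib power_commutes)
    ultimately show "(\<Sum>n. z ^ n) * (1 - z) = 1"
      using sums_unique2[OF _ tel] by simp
    have "(\<lambda>n. (1 - z) * z ^ n) sums ((1 - z) * (\<Sum>n. z ^ n))"
      by (intro sums_mult summable_sums sm)
    moreover have "(\<lambda>n. (1 - z) * z ^ n) = (\<lambda>n. z ^ n - z ^ Suc n)"
      by (simp add: left_diff_distrib)
    ultimately show "(1 - z) * (\<Sum>n. z ^ n) = 1"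
      using sums_unique2[OF _ tel] by simp
  qed
qed

text \<open>
  The hypothesis confines \<open>h\<close> between \<open>\<epsilon>\<close> and \<open>t\<close> for large \<open>t\<close>, hence \<open>t - h\<close> has norm at most
  \<open>t - \<epsilon> < t\<close>, and \<open>h / t\<close> is inverted by a geometric series.
\<close>

lemma invertible_of_cstar_le:
  assumes "\<epsilon> *\<^sub>R 1 \<sqsubseteq> h" "\<epsilon> > 0"
  obtains k where "k * h = 1" "h * k = 1"
proof -
  define t where "t = norm h + \<epsilon>"
  have "t > 0" using assms(2) norm_ge_zero[of h] unfolding t_def by linarith
  have "cstar_positive h"
    by (rule cstar_positive_mono[OF _ assms(1)]) (use assms(2) in \<open>simp add: cstar_positive_scaleR\<close>)
  then have "h \<sqsubseteq> norm h *\<^sub>R 1" by (intro cstar_le_norm cstar_positive_star) auto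
  also have "norm h *\<^sub>R 1 \<sqsubseteq> t *\<^sub>R (1 :: 'a)"
    using assms(2) by (intro cstar_le_scaleR_left) (auto simp: t_def)
  finally have "h \<sqsubseteq> t *\<^sub>R 1" .
  have "norm (t *\<^sub>R 1 - h) \<le> t - \<epsilon>"
  proof (rule norm_le_of_cstar_le)
    show "cstar_positive (t *\<^sub>R 1 - h)" using \<open>h \<sqsubseteq> t *\<^sub>R 1\<close> by (simp add: cstar_le_def)
    show "t *\<^sub>R 1 - h \<sqsubseteq> (t - \<epsilon>) *\<^sub>R 1" using assms(1) by (simp add: cstar_le_def algebra_simps)
  qed (simp add: t_def)
  define z where "z = (1 / t) *\<^sub>R (t *\<^sub>R 1 - h)"
  have "norm z = norm (t *\<^sub>R 1 - h) / t"
    using \<open>t > 0\<close> by (simp add: z_def)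
  also have "\<dots> < 1"
    using \<open>t > 0\<close> assms(2) \<open>norm (t *\<^sub>R 1 - h) \<le> t - \<epsilon>\<close> by (simp add: divide_simps)
  finally obtain k where k: "k * (1 - z) = 1" "(1 - z) * k = 1"
    by (rule one_minus_invertible)
  have "1 - z = (1 / t) *\<^sub>R h"
    using \<open>t > 0\<close> by (simp add: z_def scaleR_diff_right)
  with k show ?thesis
    by (intro that[of "(1 / t) *\<^sub>R k"]) simp_all
qed

section \<open>Imaginary parts and half-planes\<close>

lemma cstar_Im_add: "cstar_Im (x + y) = cstar_Im x + cstar_Im y"
  by (simp add: cstar_Im_def star_add flip: scaleC_add_right) (simp add: algebra_simps)

lemma cstar_Im_minus [simp]: "cstar_Im (- x) = - cstar_Im (x::'a::unital_cstar_algebra)"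
  using cstar_Im_add[of x "- x"] cstar_Im_add[of 0 "0::'a"] by (simp add: eq_neg_iff_add_eq_0 add.commute)

lemma cstar_Im_diff: "cstar_Im (x - y) = cstar_Im x - cstar_Im y"
  using cstar_Im_add[of x "- y"] by simp

lemma star_cstar_Im: "star (cstar_Im x) = cstar_Im x"
proof -
  have "star (cstar_Im x) = (- (1 / (2 * \<i>))) *\<^sub>C (star x - x)"
    by (simp add: cstar_Im_def star_scaleC star_diff star_star)
  also have "\<dots> = cstar_Im x"
    by (simp add: cstar_Im_def cvec.scale_minus_left cvec.scale_right_diff_distrib)
  finally show ?thesis .
qed

lemma cstar_Im_star: "cstar_Im (star x) = - cstar_Im x"
  by (simp add: cstar_Im_def star_star cvec.scale_right_diff_distrib)

lemma cstar_Im_congruence: "cstar_Im (star q * x * q) = star q * cstar_Im x * q"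
  by (simp add: cstar_Im_def star_mult star_star mult_scaleC_left mult_scaleC_right
      algebra_simps cvec.scale_right_diff_distrib)

lemma norm_cstar_Im_le: "norm (cstar_Im x) \<le> norm x"
  using norm_triangle_ineq4[of x "star x"] by (simp add: cstar_Im_def norm_scaleC norm_divide)

lemma upper_half_closed_perturb:
  assumes "b \<in> upper_half_closed \<gamma>" "norm k \<le> r"
  shows "b + k \<in> upper_half_closed (\<gamma> - r)"
proof -
  have "- (r *\<^sub>R 1) \<sqsubseteq> cstar_Im k"
    using norm_cstar_Im_le[of k] assms(2) by (intro cstar_le_norm star_cstar_Im) linarith
  from cstar_le_add[of "\<gamma> *\<^sub>R 1" "cstar_Im b", OF _ this] assms(1) show ?thesis
    by (simp add: upper_half_closed_def cstar_Im_add scaleR_diff_left)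
qed

lemma upper_half_iff_closed: "b \<in> upper_half \<longleftrightarrow> (\<exists>\<gamma>>0. b \<in> upper_half_closed \<gamma>)"
  by (simp add: upper_half_def upper_half_closed_def)

lemma upper_half_closed_subset: "\<gamma> > 0 \<Longrightarrow> upper_half_closed \<gamma> \<subseteq> upper_half"
  by (auto simp: upper_half_iff_closed)

lemma upper_half_closed_nonempty: "upper_half_closed \<gamma> \<noteq> ({} :: 'a::unital_cstar_algebra set)"
proof -
  have "cstar_Im ((complex_of_real \<gamma> * \<i>) *\<^sub>C 1) = \<gamma> *\<^sub>R (1::'a)"
    by (simp add: cstar_Im_def star_scaleC scaleR_scaleC scaleC_scaleC cvec.scale_right_diff_distrib
        scaleC_add_left[symmetric] field_simps)
  then show ?thesis
    by (auto simp: upper_half_closed_def intro!: exI[of _ "(complex_of_real \<gamma> * \<i>) *\<^sub>C 1"])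
qed

section \<open>Positive two-by-two blocks\<close>

text \<open>
  Positivity of the matrix with rows \<open>a, h\<close> and \<open>star h, c\<close>, expressed through its quadratic
  form. In this form sums, monotonicity in the diagonal and diagonal congruences reduce at once to
  facts on positive elements of the algebra itself.
\<close>

definition block_positive :: "'a::unital_cstar_algebra \<Rightarrow> 'a \<Rightarrow> 'a \<Rightarrow> bool" where
  "block_positive a h c \<longleftrightarrow> (\<forall>u v. cstar_positive
     (star u * a * u + star u * h * v + star v * star h * u + star v * c * v))"

lemma block_positive_add:
  assumes "block_positive a h c" "block_positive a' h' c'"
  shows "block_positive (a + a') (h + h') (c + c')"
  unfolding block_positive_def
proof (intro allI)
  fix u v :: 'a
  show "cstar_positive (star u * (a + a') * u + star u * (h + h') * v
      + star v * star (h + h') * u + star v * (c + c') * v)"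
    using cstar_positive_add[OF assms(1)[unfolded block_positive_def, rule_format, of u v]
        assms(2)[unfolded block_positive_def, rule_format, of u v]]
    by (simp add: algebra_simps star_add)
qed

lemma block_positive_mono:
  assumes "block_positive a h c" "a \<sqsubseteq> a'" "c \<sqsubseteq> c'"
  shows "block_positive a' h c'"
proof -
  have "block_positive (a' - a) 0 (c' - c)"
    using assms(2,3) unfolding block_positive_def cstar_le_def
    by (simp add: cstar_positive_add cstar_positive_congruence)
  from block_positive_add[OF assms(1) this] show ?thesis by simp
qed

lemma block_positive_congruence:
  assumes "block_positive a h c"
  shows "block_positive (star x * a * x) (star x * h * y) (star y * c * y)"
  unfolding block_positive_def
proof (intro allI)
  fix u v :: 'a
  show "cstar_positive (star u * (star x * a * x) * u + star u * (star x * h * y) * v +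
           star v * star (star x * h * y) * u + star v * (star y * c * y) * v)"
    using assms[unfolded block_positive_def, rule_format, of "x * u" "y * v"]
    by (simp add: star_mult star_star mult.assoc)
qed

text \<open>
  Completing the square, the quadratic form is \<open>r\<close> times the square of \<open>u + h v / r\<close> plus the form of
  \<open>(r\<^sup>2 - star h * h) / r\<close> at \<open>v\<close>.
\<close>

lemma block_positive_of_norm_le:
  assumes "norm h \<le> r"
  shows "block_positive (r *\<^sub>R 1) h (r *\<^sub>R 1)"
proof (cases "r = 0")
  case False
  with assms have "r > 0" using norm_ge_zero[of h] by linarith
  have "norm (star h * h) \<le> r\<^sup>2"
    using assms by (simp add: norm_star_mult_self power_mono)
  then have hh: "star h * h \<sqsubseteq> r\<^sup>2 *\<^sub>R 1"
    by (intro cstar_le_norm(1)) (simp_all add: star_mult star_star)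
  show ?thesis
    unfolding block_positive_def
  proof (intro allI)
    fix u v :: 'a
    define y where "y = u + (1 / r) *\<^sub>R (h * v)"
    have "r *\<^sub>R (star y * y) + (1 / r) *\<^sub>R (star v * (r\<^sup>2 *\<^sub>R 1 - star h * h) * v)
        = star u * r *\<^sub>R 1 * u + star u * h * v + star v * star h * u + star v * r *\<^sub>R 1 * v"
      using \<open>r > 0\<close>
      by (simp add: y_def star_add star_mult algebra_simps power2_eq_square)
    moreover have "cstar_positive (r *\<^sub>R (star y * y) + (1 / r) *\<^sub>R (star v * (r\<^sup>2 *\<^sub>R 1 - star h * h) * v))"
      using \<open>r > 0\<close> hh
      by (intro cstar_positive_add cstar_positive_scaleR cstar_positive_congruence) (auto simp: cstar_le_def)
    ultimately show "cstar_positive (star u * r *\<^sub>R 1 * u + star u * h * v + star v * star h * u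
        + star v * r *\<^sub>R 1 * v)"
      by simp
  qed
qed (use assms in \<open>simp add: block_positive_def\<close>)

text \<open>
  Testing the block with constant diagonal \<open>r\<close> on the vector \<open>(- h, r)\<close> gives \<open>star h * h \<le> r\<^sup>2\<close>.
\<close>

lemma norm_le_of_block_positive:
  assumes "block_positive a h c" "a \<sqsubseteq> r *\<^sub>R 1" "c \<sqsubseteq> r *\<^sub>R 1" "r > 0"
  shows "norm h \<le> r"
proof -
  have "block_positive (r *\<^sub>R 1) h (r *\<^sub>R 1)"
    using assms block_positive_mono by blast
  from this[unfolded block_positive_def, rule_format, of "- h" "r *\<^sub>R 1"]
  have "cstar_positive (r *\<^sub>R (r\<^sup>2 *\<^sub>R 1 - star h * h))"
    by (simp add: algebra_simps power2_eq_square)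
  from cstar_positive_scaleR[OF this, of "1 / r"]
  have "star h * h \<sqsubseteq> r\<^sup>2 *\<^sub>R 1"
    using assms(4) by (simp add: cstar_le_def)
  then have "norm (star h * h) \<le> r\<^sup>2"
    by (intro norm_le_of_cstar_le) auto
  then show ?thesis
    using assms(4) by (simp add: norm_star_mult_self power2_le_iff_abs_le)
qed

definition block_matrix :: "'a \<Rightarrow> 'a \<Rightarrow> 'a \<Rightarrow> 'a \<Rightarrow> 'a^2^2" where
  "block_matrix a h k c = (\<chi> i j. if i = 1 then (if j = 1 then a else h) else (if j = 1 then k else c))"

lemma block_matrix_nth [simp]:
  "block_matrix a h k c $ 1 $ 1 = a" "block_matrix a h k c $ 1 $ 2 = h"
  "block_matrix a h k c $ 2 $ 1 = k" "block_matrix a h k c $ 2 $ 2 = c"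
  by (simp_all add: block_matrix_def)

lemma mat2_eq_iff: "A = B \<longleftrightarrow>
   A $ 1 $ 1 = B $ 1 $ 1 \<and> A $ 1 $ 2 = B $ 1 $ 2 \<and> A $ 2 $ 1 = B $ 2 $ 1 \<and> A $ 2 $ 2 = (B :: 'a^2^2) $ 2 $ 2"
  by (auto simp: vec_eq_iff forall_2)

lemma mat2_star_mult_self_nth:
  "(mat2_star X ** X) $ i $ j = star (X $ 1 $ i) * X $ 1 $ j + star (X $ 2 $ i) * X $ 2 $ j"
  by (simp add: mat2_star_def matrix_matrix_mult_def sum_2)

lemma mat2_positive_imp_block_positive:
  assumes "mat2_positive A"
  shows "block_positive (A $ 1 $ 1) (A $ 1 $ 2) (A $ 2 $ 2)" "A $ 2 $ 1 = star (A $ 1 $ 2)"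
proof -
  obtain X where A: "A = mat2_star X ** X"
    using assms by (auto simp: mat2_positive_def)
  show "A $ 2 $ 1 = star (A $ 1 $ 2)"
    by (simp add: A mat2_star_mult_self_nth star_add star_mult star_star)
  show "block_positive (A $ 1 $ 1) (A $ 1 $ 2) (A $ 2 $ 2)"
    unfolding block_positive_def
  proof (intro allI)
    fix u v :: 'a
    define y where "y i = X $ i $ 1 * u + X $ i $ 2 * v" for i
    have "star u * A $ 1 $ 1 * u + star u * A $ 1 $ 2 * v + star v * star (A $ 1 $ 2) * u
        + star v * A $ 2 $ 2 * v = star (y 1) * y 1 + star (y 2) * y 2"
      by (simp add: y_def A mat2_star_mult_self_nth star_add star_mult star_star algebra_simps)
    then show "cstar_positive (star u * A $ 1 $ 1 * u + star u * A $ 1 $ 2 * v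
        + star v * star (A $ 1 $ 2) * u + star v * A $ 2 $ 2 * v)"
      by (simp add: cstar_positive_add)
  qed
qed

text \<open>
  A Cholesky factorisation: with \<open>\<alpha> = sqrt a\<close> invertible and \<open>\<beta>\<close> the square root of the Schur
  complement \<open>c - star h * a\<^sup>-\<^sup>1 * h\<close>, the block is \<open>star X * X\<close> for the upper triangular matrix
  \<open>X\<close> with rows \<open>\<alpha>, \<alpha>\<^sup>-\<^sup>1 h\<close> and \<open>0, \<beta>\<close>.
\<close>

lemma mat2_positive_of_block_positive:
  assumes bp: "block_positive a h c" and "\<epsilon> *\<^sub>R 1 \<sqsubseteq> a" "\<epsilon> > 0"
  shows "mat2_positive (block_matrix a h (star h) c)"
proof -
  have "cstar_positive a"
    by (rule cstar_positive_mono[OF _ assms(2)]) (use assms(3) in \<open>simp add: cstar_positive_scaleR\<close>)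
  then obtain \<alpha> where \<alpha>: "star \<alpha> = \<alpha>" "\<alpha> * \<alpha> = a"
    unfolding cstar_positive_iff_metric using metric_positive_sqrt by metis
  obtain k where k: "k * a = 1" "a * k = 1"
    using invertible_of_cstar_le[OF assms(2,3)] .
  define \<rho> where "\<rho> = k * \<alpha>"
  have r1: "\<rho> * \<alpha> = 1" by (simp add: \<rho>_def mult.assoc \<alpha> k)
  have "\<rho> = \<rho> * (\<alpha> * (\<alpha> * k))" using k(2) by (simp add: \<alpha>(2) flip: mult.assoc)
  also have "\<dots> = \<alpha> * k" by (metis r1 mult.assoc mult_1)
  finally have r2: "\<alpha> * \<rho> = 1" using k(2) \<alpha>(2) by (metis mult.assoc)
  then have r2': "\<alpha> * (\<rho> * x) = x" for x by (simp flip: mult.assoc)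
  have sr: "star \<rho> = \<rho>"
  proof -
    have "star \<rho> * \<alpha> = 1" using r2 \<alpha>(1) by (metis star_mult star_one)
    then show ?thesis using r2 by (metis mult.assoc mult.right_neutral mult_1)
  qed
  have inv: "\<rho> * \<rho> * a = 1" "a * (\<rho> * \<rho>) = 1"
    unfolding \<alpha>(2)[symmetric] using r1 r2 by (metis mult.assoc mult_1)+
  define n where "n = \<rho> * \<rho>"
  have sn: "star n = n" by (simp add: n_def star_mult sr)
  have "n * (a * x) = x" for x using inv(1) by (simp add: n_def flip: mult.assoc)
  then have "star (- (n * h)) * a * (- (n * h)) = star h * n * h"
    by (simp add: star_mult sn mult.assoc)
  with bp[unfolded block_positive_def, rule_format, of "- (n * h)" 1]
  have "cstar_positive (c - star h * n * h)"
    by (simp add: star_mult sn mult.assoc)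
  then obtain \<beta> where \<beta>: "star \<beta> = \<beta>" "\<beta> * \<beta> = c - star h * n * h"
    unfolding cstar_positive_iff_metric using metric_positive_sqrt by metis
  have "block_matrix a h (star h) c = mat2_star (block_matrix \<alpha> (\<rho> * h) 0 \<beta>) ** block_matrix \<alpha> (\<rho> * h) 0 \<beta>"
    unfolding mat2_eq_iff mat2_star_mult_self_nth
    by (simp add: \<alpha> \<beta> star_mult sr n_def mult.assoc r1 r2')
  then show ?thesis unfolding mat2_positive_def by blast
qed

lemma two_positive_block:
  assumes "two_positive f" "block_positive a h c" "\<epsilon> *\<^sub>R 1 \<sqsubseteq> a" "\<epsilon> > 0"
  shows "block_positive (f a) (f h) (f c)"
proof -
  have "mat2_positive (amplification2 f (block_matrix a h (star h) c))"
    using assms mat2_positive_of_block_positive unfolding two_positive_def by blast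
  from mat2_positive_imp_block_positive(1)[OF this] show ?thesis
    by (simp add: amplification2_def)
qed

text \<open>
  The lower left corner of a positive matrix is the adjoint of its upper right corner, and every
  \<open>h\<close> occurs as a corner of a positive matrix.
\<close>

lemma two_positive_star:
  assumes "two_positive f"
  shows "f (star h) = star (f h)"
proof -
  have "mat2_positive (block_matrix (star h * h) (star h) h 1)"
    unfolding mat2_positive_def mat2_eq_iff mat2_star_mult_self_nth
    by (rule exI[of _ "block_matrix h 1 0 0"]) simp
  with assms have "mat2_positive (amplification2 f (block_matrix (star h * h) (star h) h 1))"
    unfolding two_positive_def by blast
  from mat2_positive_imp_block_positive(2)[OF this] have "f h = star (f (star h))"
    by (simp add: amplification2_def)
  then show ?thesis by (metis star_star)
qed

lemma two_positive_positive:
  assumes "two_positive f" "cstar_positive a"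
  shows "cstar_positive (f a)"
proof -
  obtain x where x: "a = star x * x" using assms(2) by (auto simp: cstar_positive_def)
  have "mat2_positive (block_matrix a 0 0 0)"
    unfolding mat2_positive_def mat2_eq_iff mat2_star_mult_self_nth
    by (rule exI[of _ "block_matrix x 0 0 0"]) (simp add: x)
  with assms(1) have "mat2_positive (amplification2 f (block_matrix a 0 0 0))"
    unfolding two_positive_def by blast
  from mat2_positive_imp_block_positive(1)[OF this, unfolded block_positive_def, rule_format, of 1 0]
  show ?thesis by (simp add: amplification2_def)
qed

lemma two_positive_Im:
  assumes "two_positive f"
  shows "f (cstar_Im x) = cstar_Im (f x)"
proof -
  interpret Vector_Spaces.linear scaleC scaleC f
    using assms by (simp add: two_positive_def)
  show ?thesis
    by (simp add: cstar_Im_def scale neg diff two_positive_star[OF assms])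
qed

section \<open>Solutions of the Dyson equation\<close>

locale two_positive_operator =
  fixes \<eta> :: "'a::unital_cstar_algebra \<Rightarrow>\<^sub>L 'a"
  assumes two_positive: "two_positive \<eta>"
begin

sublocale cl: Vector_Spaces.linear scaleC scaleC "blinfun_apply \<eta>"
  using two_positive by (simp add: two_positive_def)

text \<open>
  The number \<open>\<gamma>\<close> quantifies how far \<open>b\<close> lies inside the half-plane. The estimates for solutions
  depend on \<open>b\<close> through it alone; starting values and rates of iterations, which also depend on the size
  of \<open>b\<close>, disappear in the limit.
\<close>

definition dyson_point :: "real \<Rightarrow> 'a \<Rightarrow> 'a \<Rightarrow> bool" where
  "dyson_point \<gamma> b g \<longleftrightarrow>
     0 < \<gamma> \<and> \<gamma> *\<^sub>R 1 \<sqsubseteq> cstar_Im b \<and> g \<in> lower_half \<and> (b - \<eta> g) * g = 1"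

lemma dyson_point_of_solution:
  assumes "dyson_solution \<eta> G" "b \<in> upper_half_closed \<gamma>" "\<gamma> > 0"
  shows "dyson_point \<gamma> b (G b)"
proof -
  have "b \<in> upper_half" using assms(2,3) upper_half_closed_subset by blast
  then show ?thesis
    using assms by (simp add: dyson_point_def dyson_solution_def upper_half_closed_def left_diff_distrib)
qed

lemma lower_half_positive:
  assumes "g \<in> lower_half"
  obtains \<epsilon> where "\<epsilon> > 0" "\<epsilon> *\<^sub>R 1 \<sqsubseteq> - cstar_Im g" "cstar_positive (- cstar_Im g)"
proof -
  obtain \<epsilon> where e: "\<epsilon> > 0" "\<epsilon> *\<^sub>R 1 \<sqsubseteq> - cstar_Im g"
    using assms by (auto simp: lower_half_def)
  then have "cstar_positive (- cstar_Im g)"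
    by (intro cstar_positive_mono[OF _ e(2)]) (simp add: cstar_positive_scaleR)
  with e that show ?thesis by blast
qed

lemma Im_denominator: "cstar_Im (b - \<eta> g) = cstar_Im b + \<eta> (- cstar_Im g)"
  by (simp add: cstar_Im_diff two_positive_Im[OF two_positive] blinfun.minus_right)

lemma dyson_Im_denominator_ge:
  assumes "dyson_point \<gamma> b g"
  shows "\<gamma> *\<^sub>R 1 \<sqsubseteq> cstar_Im (b - \<eta> g)"
proof -
  have "cstar_positive (- cstar_Im g)"
    using assms lower_half_positive unfolding dyson_point_def by blast
  then have "0 \<sqsubseteq> \<eta> (- cstar_Im g)"
    by (simp add: cstar_le_def two_positive_positive[OF two_positive])
  from cstar_le_add[OF _ this] assms show ?thesis
    unfolding Im_denominator dyson_point_def by fastforce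
qed

text \<open>
  The equation only says that \<open>g\<close> is a right inverse of \<open>w = b - \<eta> g\<close>. Since \<open>w * (1 - g * w) = 0\<close>
  and \<open>w\<close> has strictly positive imaginary part, compressing that imaginary part by \<open>1 - g * w\<close> shows
  that \<open>g\<close> is also a left inverse.
\<close>

lemma dyson_left_inverse:
  assumes "dyson_point \<gamma> b g"
  shows "g * (b - \<eta> g) = 1"
proof -
  define w where "w = b - \<eta> g"
  define q where "q = 1 - g * w"
  have wg: "w * g = 1" and pos: "\<gamma> > 0" using assms by (simp_all add: dyson_point_def w_def)
  have wq: "w * q = 0" by (simp add: q_def right_diff_distrib wg flip: mult.assoc)
  have "star q * cstar_Im w * q = cstar_Im (star q * (w * q))"
    by (metis cstar_Im_congruence mult.assoc)
  also have "\<dots> = 0" by (simp add: wq cstar_Im_def)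
  finally have "star q * cstar_Im w * q = 0" .
  moreover have "star q * (\<gamma> *\<^sub>R 1) * q \<sqsubseteq> star q * cstar_Im w * q"
    using cstar_le_congruence dyson_Im_denominator_ge[OF assms] unfolding w_def by blast
  ultimately have "cstar_positive (- (\<gamma> *\<^sub>R (star q * q)))"
    by (simp add: cstar_le_def)
  from cstar_positive_scaleR[OF this, of "1 / \<gamma>"]
  have "cstar_positive (- (star q * q))"
    using pos by simp
  then have "q = 0"
    unfolding cstar_positive_iff_metric by (rule negative_star_mult_self_eq_zero)
  then show ?thesis by (simp add: q_def w_def)
qed

lemma dyson_Im_eq:
  assumes "dyson_point \<gamma> b g" and "x = g \<or> x = star g"
  shows "- cstar_Im g = star x * cstar_Im (b - \<eta> g) * x"
proof -
  let ?w = "b - \<eta> g"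
  have "?w * g = 1" "g * ?w = 1"
    using assms dyson_left_inverse by (simp_all add: dyson_point_def)
  then have "star g * ?w * g = star g" "g * ?w * star g = star g"
    by (simp_all add: mult.assoc)
  then have "star x * ?w * x = star g"
    using assms(2) by (auto simp: star_star)
  then show ?thesis
    using cstar_Im_congruence[of x ?w] by (simp add: cstar_Im_star)
qed

lemma dyson_norm_le:
  assumes "dyson_point \<gamma> b g"
  shows "norm g \<le> 1 / \<gamma>"
proof (cases "g = 0")
  case False
  have pos: "\<gamma> > 0" using assms by (simp add: dyson_point_def)
  have "star g * (\<gamma> *\<^sub>R 1) * g \<sqsubseteq> - cstar_Im g"
    unfolding dyson_Im_eq[OF assms disjI1[OF refl]]
    by (intro cstar_le_congruence dyson_Im_denominator_ge assms)
  then have "norm (\<gamma> *\<^sub>R (star g * g)) \<le> norm (- cstar_Im g)"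
    using pos by (intro norm_mono_cstar_le) (simp_all add: cstar_positive_scaleR)
  also have "\<dots> \<le> norm g" using norm_cstar_Im_le by simp
  finally have "\<gamma> * norm g * norm g \<le> 1 * norm g"
    using pos by (simp add: norm_star_mult_self power2_eq_square mult.assoc)
  then have "\<gamma> * norm g \<le> 1" using False by simp
  then show ?thesis using pos by (simp add: field_simps)
qed (use assms in \<open>simp add: dyson_point_def\<close>)

lemma dyson_Im_le:
  assumes "dyson_point \<gamma> b g" "c \<ge> 0"
  shows "c *\<^sub>R (- cstar_Im g) \<sqsubseteq> (c / \<gamma>) *\<^sub>R 1"
proof -
  have "- cstar_Im g \<sqsubseteq> (1 / \<gamma>) *\<^sub>R 1"
    using norm_cstar_Im_le[of g] dyson_norm_le[OF assms(1)]
    by (intro cstar_le_norm) (simp_all add: star_cstar_Im)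
  from cstar_le_scaleR[OF this assms(2)] show ?thesis by simp
qed

section \<open>The linearised equation\<close>

text \<open>
  With \<open>v = - cstar_Im g\<close> and \<open>x = g\<close> or \<open>x = star g\<close>, the positive map
  \<open>h \<mapsto> star x * \<eta> h * x\<close> sends \<open>v\<close> to \<open>v - A\<close> with \<open>A = star x * cstar_Im b * x\<close>. The remainder
  \<open>A\<close> dominates \<open>\<gamma> * (star x * x)\<close>, with a constant that is uniform in \<open>b\<close>, and also a multiple
  \<open>\<delta>\<close> of \<open>v\<close>, with a constant that is not. The first gives the size of the bounds below, the second
  only the convergence of iterations.
\<close>

lemma dyson_weight:
  assumes p: "dyson_point \<gamma> b g" and x: "x = g \<or> x = star g"
    and \<delta>: "\<delta> * norm (cstar_Im (b - \<eta> g)) \<le> \<gamma>" "\<delta> \<ge> 0" and \<kappa>: "0 \<le> \<kappa>" "\<kappa> \<le> c"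
  shows "star x * \<eta> (c *\<^sub>R (- cstar_Im g)) * x + star x * ((\<kappa> * \<gamma>) *\<^sub>R 1) * x
    \<sqsubseteq> (\<kappa> + (c - \<kappa>) * (1 - \<delta>)) *\<^sub>R (- cstar_Im g)"
proof -
  define w where "w = b - \<eta> g"
  define v where "v = - cstar_Im g"
  define A where "A = star x * cstar_Im b * x"
  have v: "v = star x * cstar_Im w * x"
    unfolding v_def w_def by (rule dyson_Im_eq[OF p x])
  have vA: "star x * \<eta> v * x = v - A"
    using v unfolding A_def w_def Im_denominator by (simp add: v_def algebra_simps)
  have b: "\<gamma> *\<^sub>R 1 \<sqsubseteq> cstar_Im b" using p by (simp add: dyson_point_def)
  have "star x * (\<gamma> *\<^sub>R 1) * x \<sqsubseteq> A"
    unfolding A_def by (intro cstar_le_congruence b)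
  then have A1: "\<kappa> *\<^sub>R (star x * (\<gamma> *\<^sub>R 1) * x) \<sqsubseteq> \<kappa> *\<^sub>R A"
    by (rule cstar_le_scaleR) fact
  have "\<delta> *\<^sub>R cstar_Im w \<sqsubseteq> \<gamma> *\<^sub>R 1"
    using \<delta> by (intro cstar_le_norm) (simp_all add: star_cstar_Im w_def)
  then have "star x * (\<delta> *\<^sub>R cstar_Im w) * x \<sqsubseteq> A"
    unfolding A_def by (intro cstar_le_congruence cstar_le_trans[OF _ b])
  then have "\<delta> *\<^sub>R v \<sqsubseteq> A" by (simp add: v)
  then have A2: "(c - \<kappa>) *\<^sub>R (\<delta> *\<^sub>R v) \<sqsubseteq> (c - \<kappa>) *\<^sub>R A"
    by (rule cstar_le_scaleR) (use \<kappa> in simp)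
  have "star x * \<eta> (c *\<^sub>R v) * x = c *\<^sub>R (v - A)"
    by (simp add: vA[symmetric] blinfun.scaleR_right)
  moreover have "c *\<^sub>R (v - A) + \<kappa> *\<^sub>R (star x * (\<gamma> *\<^sub>R 1) * x) \<sqsubseteq> c *\<^sub>R (v - A) + \<kappa> *\<^sub>R A"
    by (intro cstar_le_add A1 cstar_le_refl)
  moreover have "c *\<^sub>R (v - A) + \<kappa> *\<^sub>R A \<sqsubseteq> (\<kappa> + (c - \<kappa>) * (1 - \<delta>)) *\<^sub>R v"
    using A2 by (simp add: cstar_le_def algebra_simps)
  ultimately show ?thesis
    using cstar_le_trans by (simp add: v_def mult.commute)
qed

text \<open>
  One step of the iteration \<open>d \<mapsto> g\<^sub>1 * \<eta> d * g\<^sub>2 + g\<^sub>1 * h * g\<^sub>2\<close>, measured by the least \<open>c\<close> for which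
  \<open>d\<close> is the corner of a positive block with diagonal \<open>c v\<^sub>1, c v\<^sub>2\<close>. The excess of \<open>c\<close> over
  \<open>\<kappa>\<close> shrinks by the factor \<open>1 - \<delta>\<close>. This is where \<open>2\<close>-positivity enters.
\<close>

lemma dyson_step:
  assumes p1: "dyson_point \<gamma> b1 g1" and p2: "dyson_point \<gamma> b2 g2"
    and \<delta>: "\<delta> * norm (cstar_Im (b1 - \<eta> g1)) \<le> \<gamma>" "\<delta> * norm (cstar_Im (b2 - \<eta> g2)) \<le> \<gamma>" "\<delta> \<ge> 0"
    and bp: "block_positive (c *\<^sub>R (- cstar_Im g1)) d (c *\<^sub>R (- cstar_Im g2))"
    and c: "c > 0" "\<kappa> \<le> c" and h: "norm h \<le> \<kappa> * \<gamma>"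
  defines "c' \<equiv> \<kappa> + (c - \<kappa>) * (1 - \<delta>)"
  shows "block_positive (c' *\<^sub>R (- cstar_Im g1)) (g1 * \<eta> d * g2 + g1 * h * g2) (c' *\<^sub>R (- cstar_Im g2))"
proof -
  have "\<gamma> > 0" using p1 by (simp add: dyson_point_def)
  have "\<kappa> * \<gamma> \<ge> 0" using h norm_ge_zero order_trans by blast
  then have "\<kappa> \<ge> 0" using \<open>\<gamma> > 0\<close> by (simp add: zero_le_mult_iff)
  obtain \<epsilon> where e: "\<epsilon> > 0" "\<epsilon> *\<^sub>R 1 \<sqsubseteq> - cstar_Im g1"
    using p1 lower_half_positive unfolding dyson_point_def by metis
  have "(c * \<epsilon>) *\<^sub>R 1 \<sqsubseteq> c *\<^sub>R (- cstar_Im g1)"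
    using cstar_le_scaleR[OF e(2), of c] c by simp
  from two_positive_block[OF two_positive bp this]
  have "block_positive (\<eta> (c *\<^sub>R (- cstar_Im g1))) (\<eta> d) (\<eta> (c *\<^sub>R (- cstar_Im g2)))"
    using e c by simp
  then have 1: "block_positive
      (star (star g1) * \<eta> (c *\<^sub>R (- cstar_Im g1)) * star g1) (star (star g1) * \<eta> d * g2)
      (star g2 * \<eta> (c *\<^sub>R (- cstar_Im g2)) * g2)"
    by (rule block_positive_congruence)
  have 2: "block_positive (star (star g1) * ((\<kappa> * \<gamma>) *\<^sub>R 1) * star g1) (star (star g1) * h * g2)
      (star g2 * ((\<kappa> * \<gamma>) *\<^sub>R 1) * g2)"
    by (intro block_positive_congruence block_positive_of_norm_le h)
  have "block_positive (c' *\<^sub>R (- cstar_Im g1)) (star (star g1) * \<eta> d * g2 + star (star g1) * h * g2)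
      (c' *\<^sub>R (- cstar_Im g2))"
    unfolding c'_def
    by (rule block_positive_mono[OF block_positive_add[OF 1 2]])
      (rule dyson_weight[OF p1 disjI2[OF refl] \<delta>(1,3) \<open>\<kappa> \<ge> 0\<close> c(2)]
        dyson_weight[OF p2 disjI1[OF refl] \<delta>(2,3) \<open>\<kappa> \<ge> 0\<close> c(2)])+
  then show ?thesis by (simp only: star_star)
qed

lemma dyson_initial_block:
  assumes p1: "dyson_point \<gamma> b1 g1" and p2: "dyson_point \<gamma> b2 g2"
  obtains c where "c > 0" "c > \<kappa>" "block_positive (c *\<^sub>R (- cstar_Im g1)) d (c *\<^sub>R (- cstar_Im g2))"
proof -
  obtain \<epsilon>1 where e1: "\<epsilon>1 > 0" "\<epsilon>1 *\<^sub>R 1 \<sqsubseteq> - cstar_Im g1"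
    using p1 lower_half_positive unfolding dyson_point_def by metis
  obtain \<epsilon>2 where e2: "\<epsilon>2 > 0" "\<epsilon>2 *\<^sub>R 1 \<sqsubseteq> - cstar_Im g2"
    using p2 lower_half_positive unfolding dyson_point_def by metis
  define c where "c = norm d / \<epsilon>1 + norm d / \<epsilon>2 + \<bar>\<kappa>\<bar> + 1"
  have nd: "norm d / \<epsilon>1 \<ge> 0" "norm d / \<epsilon>2 \<ge> 0" using e1 e2 by simp_all
  then have c: "c > 0" "c > \<kappa>" unfolding c_def by linarith+
  have *: "norm d *\<^sub>R 1 \<sqsubseteq> c *\<^sub>R v" if "\<epsilon> > 0" "\<epsilon> *\<^sub>R 1 \<sqsubseteq> v" "norm d / \<epsilon> \<le> c" for v :: 'a and \<epsilon>
  proof -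
    have "norm d *\<^sub>R 1 \<sqsubseteq> (c * \<epsilon>) *\<^sub>R (1::'a)"
      using that by (intro cstar_le_scaleR_left) (simp_all add: field_simps)
    also have "(c * \<epsilon>) *\<^sub>R (1::'a) \<sqsubseteq> c *\<^sub>R v"
      using cstar_le_scaleR[OF that(2), of c] c by simp
    finally show ?thesis .
  qed
  have "block_positive (c *\<^sub>R (- cstar_Im g1)) d (c *\<^sub>R (- cstar_Im g2))"
  proof (rule block_positive_mono[OF block_positive_of_norm_le[OF order_refl]])
    from nd have "norm d / \<epsilon>1 \<le> c" "norm d / \<epsilon>2 \<le> c" by (auto simp: c_def)
    with * e1 e2 show "norm d *\<^sub>R 1 \<sqsubseteq> c *\<^sub>R (- cstar_Im g1)" "norm d *\<^sub>R 1 \<sqsubseteq> c *\<^sub>R (- cstar_Im g2)"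
      by blast+
  qed
  with c that show ?thesis by blast
qed

lemma dyson_norm_le_of_block:
  assumes "dyson_point \<gamma> b1 g1" "dyson_point \<gamma> b2 g2" "c > 0"
    and "block_positive (c *\<^sub>R (- cstar_Im g1)) d (c *\<^sub>R (- cstar_Im g2))"
  shows "norm d \<le> c / \<gamma>"
  using assms(1,3) by (intro norm_le_of_block_positive[OF assms(4)] dyson_Im_le[OF assms(1)] dyson_Im_le[OF assms(2)])
    (auto simp: dyson_point_def)

lemma dyson_contraction_factor:
  assumes "\<gamma> > 0"
  obtains \<delta> :: real where "0 < \<delta>" "\<delta> < 1" "\<delta> * norm (x::'a) \<le> \<gamma>" "\<delta> * norm (y::'a) \<le> \<gamma>"
proof -
  \<comment> \<open>The term \<open>2 * \<gamma>\<close> makes \<open>\<gamma> / N < 1\<close>, so that powers of \<open>1 - \<delta>\<close> stay positive.\<close>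
  define N where "N = 2 * \<gamma> + norm x + norm y"
  have N: "N > 0" "\<gamma> < N" "norm x \<le> N" "norm y \<le> N"
    using assms norm_ge_zero[of x] norm_ge_zero[of y] unfolding N_def by linarith+
  have "\<gamma> * norm x \<le> \<gamma> * N" "\<gamma> * norm y \<le> \<gamma> * N"
    using N assms by simp_all
  then show ?thesis
    using N assms by (intro that[of "\<gamma> / N"]) (simp_all add: divide_simps)
qed

text \<open>
  Writing \<open>h\<close> for the value of the linearised operator at \<open>d\<close>, the element \<open>d\<close> is a fixed point of
  the iteration above with \<open>\<kappa> = norm h / \<gamma>\<close>. So it is the corner of a block for values of \<open>c\<close>
  arbitrarily close to \<open>\<kappa>\<close>, and the rate of the iteration drops out of the bound.
\<close>

lemma dyson_linearisation_bounded_below: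
  assumes p1: "dyson_point \<gamma> b1 g1" and p2: "dyson_point \<gamma> b2 g2"
  shows "\<gamma>\<^sup>2 * norm d \<le> norm ((b1 - \<eta> g1) * d * (b2 - \<eta> g2) - \<eta> d)"
proof -
  define h where "h = (b1 - \<eta> g1) * d * (b2 - \<eta> g2) - \<eta> d"
  define \<kappa> where "\<kappa> = norm h / \<gamma>"
  have pos: "\<gamma> > 0" using p1 by (simp add: dyson_point_def)
  have "g1 * ((b1 - \<eta> g1) * d * (b2 - \<eta> g2)) * g2 = (g1 * (b1 - \<eta> g1)) * d * ((b2 - \<eta> g2) * g2)"
    by (simp only: mult.assoc)
  also have "\<dots> = d"
    using dyson_left_inverse[OF p1] p2 by (simp add: dyson_point_def)
  finally have d: "g1 * \<eta> d * g2 + g1 * h * g2 = d"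
    by (simp add: h_def algebra_simps)
  obtain \<delta> where \<delta>: "0 < \<delta>" "\<delta> < 1" "\<delta> * norm (cstar_Im (b1 - \<eta> g1)) \<le> \<gamma>"
      "\<delta> * norm (cstar_Im (b2 - \<eta> g2)) \<le> \<gamma>"
    using dyson_contraction_factor[OF pos] .
  obtain c0 where c0: "c0 > 0" "c0 > \<kappa>" "block_positive (c0 *\<^sub>R (- cstar_Im g1)) d (c0 *\<^sub>R (- cstar_Im g2))"
    using dyson_initial_block[OF p1 p2] .
  define c where "c n = \<kappa> + (c0 - \<kappa>) * (1 - \<delta>) ^ n" for n
  have "\<kappa> \<ge> 0" using pos by (simp add: \<kappa>_def)
  have ck: "c n > \<kappa>" for n using c0 \<delta> by (simp add: c_def)
  have cpos: "c n > 0" for n using ck[of n] \<open>\<kappa> \<ge> 0\<close> by linarith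
  have "block_positive (c n *\<^sub>R (- cstar_Im g1)) d (c n *\<^sub>R (- cstar_Im g2))" for n
  proof (induction n)
    case (Suc n)
    have "norm h \<le> \<kappa> * \<gamma>" using pos by (simp add: \<kappa>_def)
    from dyson_step[OF p1 p2 \<delta>(3,4) _ Suc cpos less_imp_le[OF ck] this] \<delta>(1)
    have "block_positive ((\<kappa> + (c n - \<kappa>) * (1 - \<delta>)) *\<^sub>R (- cstar_Im g1)) d
        ((\<kappa> + (c n - \<kappa>) * (1 - \<delta>)) *\<^sub>R (- cstar_Im g2))" by (simp only: d)
    moreover have "\<kappa> + (c n - \<kappa>) * (1 - \<delta>) = c (Suc n)" by (simp add: c_def)
    ultimately show ?case by simp
  qed (use c0 in \<open>simp add: c_def\<close>)
  then have "norm d \<le> c n / \<gamma>" for n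
    by (rule dyson_norm_le_of_block[OF p1 p2 cpos])
  moreover have "(\<lambda>n. c n / \<gamma>) \<longlonglongrightarrow> (\<kappa> + (c0 - \<kappa>) * 0) / \<gamma>"
    unfolding c_def using \<delta> pos by (intro tendsto_intros LIMSEQ_power_zero) auto
  ultimately have "norm d \<le> (\<kappa> + (c0 - \<kappa>) * 0) / \<gamma>"
    by (intro LIMSEQ_le_const) auto
  then show ?thesis
    using pos by (simp add: \<kappa>_def h_def field_simps power2_eq_square)
qed

text \<open>
  The Neumann series of \<open>d \<mapsto> g * \<eta> d * g\<close> converges: with \<open>\<kappa> = 0\<close>, one step multiplies the size
  of the enclosing block by \<open>1 - \<delta>\<close>.
\<close>

lemma dyson_linearisation_surjective:
  assumes p: "dyson_point \<gamma> b g"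
  shows "\<exists>d. (b - \<eta> g) * d * (b - \<eta> g) - \<eta> d = h"
proof -
  define S where "S d = g * \<eta> d * g" for d
  define x where "x n = (S ^^ n) (g * h * g)" for n
  have pos: "\<gamma> > 0" using p by (simp add: dyson_point_def)
  have bl: "bounded_linear S"
    unfolding S_def
    by (intro bounded_linear_mult_const bounded_linear_const_mult blinfun.bounded_linear_right)
  obtain \<delta> where \<delta>: "0 < \<delta>" "\<delta> < 1" "\<delta> * norm (cstar_Im (b - \<eta> g)) \<le> \<gamma>"
    using dyson_contraction_factor[OF pos] by metis
  obtain c0 where c0: "c0 > 0" "block_positive (c0 *\<^sub>R (- cstar_Im g)) (x 0) (c0 *\<^sub>R (- cstar_Im g))"
    using dyson_initial_block[OF p p] by metis
  define c where "c n = c0 * (1 - \<delta>) ^ n" for n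
  have cpos: "c n > 0" for n using c0 \<delta> by (simp add: c_def)
  have "block_positive (c n *\<^sub>R (- cstar_Im g)) (x n) (c n *\<^sub>R (- cstar_Im g))" for n
  proof (induction n)
    case (Suc n)
    from dyson_step[OF p p \<delta>(3,3) _ Suc cpos, of 0 0] \<delta>(1) cpos[of n]
    show ?case by (simp add: x_def S_def c_def mult_ac)
  qed (use c0 in \<open>simp add: c_def\<close>)
  then have "norm (x n) \<le> c n / \<gamma>" for n
    by (rule dyson_norm_le_of_block[OF p p cpos])
  moreover have "summable (\<lambda>n. c n / \<gamma>)"
    unfolding c_def using \<delta> by (intro summable_divide summable_mult summable_geometric) auto
  ultimately have sm: "summable x"
    by (intro summable_comparison_test'[of "\<lambda>n. c n / \<gamma>" 0 x]) auto
  define d where "d = (\<Sum>n. x n)"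
  have "S d = (\<Sum>n. S (x n))"
    unfolding d_def by (rule bounded_linear.suminf[OF bl sm])
  also have "\<dots> = (\<Sum>n. x (Suc n))" by (simp add: x_def)
  also have "\<dots> = d - x 0" unfolding d_def by (rule suminf_split_head[OF sm])
  finally have d: "d = S d + x 0" by simp
  let ?w = "b - \<eta> g"
  have wg: "?w * g = 1" "g * ?w = 1"
    using p dyson_left_inverse by (simp_all add: dyson_point_def)
  have "?w * (g * y * g) * ?w = (?w * g) * y * (g * ?w)" for y
    by (simp only: mult.assoc)
  then have wgw: "?w * (g * y * g) * ?w = y" for y by (simp add: wg)
  have "?w * d * ?w = ?w * S d * ?w + ?w * x 0 * ?w"
    by (subst d) (simp only: distrib_left distrib_right)
  also have "\<dots> = \<eta> d + h" by (simp only: S_def x_def funpow_0 wgw)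
  finally show ?thesis by (metis add_diff_cancel_left')
qed

text \<open>
  The inverse of the linearised operator. Up to the sign it is the derivative of the solution with
  respect to \<open>b\<close>.
\<close>

definition response :: "'a \<Rightarrow> 'a \<Rightarrow> 'a \<Rightarrow> 'a" where
  "response b g h = (SOME d. (b - \<eta> g) * d * (b - \<eta> g) - \<eta> d = h)"

lemma response:
  assumes "dyson_point \<gamma> b g"
  shows "(b - \<eta> g) * response b g h * (b - \<eta> g) - \<eta> (response b g h) = h"
  unfolding response_def by (rule someI_ex[OF dyson_linearisation_surjective[OF assms]])

lemma response_norm_le:
  assumes "dyson_point \<gamma> b g"
  shows "norm (response b g h) \<le> norm h / \<gamma>\<^sup>2"
proof -
  have "\<gamma> > 0" using assms by (simp add: dyson_point_def)
  with dyson_linearisation_bounded_below[OF assms assms, of "response b g h"] show ?thesis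
    unfolding response[OF assms] by (simp add: field_simps)
qed

lemma response_unique:
  assumes p: "dyson_point \<gamma> b g" and "(b - \<eta> g) * d * (b - \<eta> g) - \<eta> d = h"
  shows "response b g h = d"
proof -
  let ?w = "b - \<eta> g"
  let ?e = "response b g h - d"
  have "?w * ?e * ?w - \<eta> ?e = 0"
    using response[OF p, of h] assms(2)
    by (simp add: right_diff_distrib left_diff_distrib blinfun.diff_right del: diff_diff_eq2)
      (simp add: algebra_simps)
  with dyson_linearisation_bounded_below[OF p p, of ?e] p
  have "norm ?e \<le> 0" by (simp add: dyson_point_def mult_le_0_iff)
  then show ?thesis by simp
qed

lemma response_add:
  assumes "dyson_point \<gamma> b g"
  shows "response b g (h + k) = response b g h + response b g k"
proof (rule response_unique[OF assms])
  let ?w = "b - \<eta> g"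
  have "?w * (x + y) * ?w - \<eta> (x + y) = (?w * x * ?w - \<eta> x) + (?w * y * ?w - \<eta> y)" for x y
    by (simp only: distrib_left distrib_right blinfun.add_right) simp
  then show "?w * (response b g h + response b g k) * ?w - \<eta> (response b g h + response b g k) = h + k"
    by (simp only: response[OF assms])
qed

lemma response_scaleC:
  assumes "dyson_point \<gamma> b g"
  shows "response b g (c *\<^sub>C h) = c *\<^sub>C response b g h"
proof (rule response_unique[OF assms])
  let ?w = "b - \<eta> g"
  have "?w * (c *\<^sub>C x) * ?w - \<eta> (c *\<^sub>C x) = c *\<^sub>C (?w * x * ?w - \<eta> x)" for x
    by (simp only: mult_scaleC_left mult_scaleC_right cl.scale cvec.scale_right_diff_distrib)
  then show "?w * (c *\<^sub>C response b g h) * ?w - \<eta> (c *\<^sub>C response b g h) = c *\<^sub>C h"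
    by (simp only: response[OF assms])
qed

lemma bounded_linear_response:
  assumes "dyson_point \<gamma> b g"
  shows "bounded_linear (response b g)"
  by (rule bounded_linear_intro[where K = "1 / \<gamma>\<^sup>2"])
    (use response_norm_le[OF assms] in
      \<open>simp_all add: response_add[OF assms] response_scaleC[OF assms] scaleR_scaleC\<close>)

section \<open>Dependence of the solution on the spectral parameter\<close>

text \<open>
  The difference of two solutions solves the equation linearised at this pair, with right-hand side
  \<open>b2 - b1\<close>. In particular, the solution at a point is unique.
\<close>

lemma dyson_lipschitz:
  assumes p1: "dyson_point \<gamma> b1 g1" and p2: "dyson_point \<gamma> b2 g2"
  shows "norm (g1 - g2) \<le> norm (b1 - b2) / \<gamma>\<^sup>2"
proof -
  define w1 where "w1 = b1 - \<eta> g1"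
  define w2 where "w2 = b2 - \<eta> g2"
  have pos: "\<gamma> > 0" using p1 by (simp add: dyson_point_def)
  have "w1 * (g1 - g2) * w2 = (w1 * g1) * w2 - w1 * (g2 * w2)"
    by (simp only: right_diff_distrib left_diff_distrib mult.assoc)
  also have "\<dots> = w2 - w1"
    using p1 dyson_left_inverse[OF p2] by (simp add: dyson_point_def w1_def w2_def)
  finally have "w1 * (g1 - g2) * w2 - \<eta> (g1 - g2) = b2 - b1"
    by (simp add: w1_def w2_def blinfun.diff_right)
  moreover have "\<gamma>\<^sup>2 * norm (g1 - g2) \<le> norm (w1 * (g1 - g2) * w2 - \<eta> (g1 - g2))"
    unfolding w1_def w2_def by (rule dyson_linearisation_bounded_below[OF p1 p2])
  ultimately have "\<gamma>\<^sup>2 * norm (g1 - g2) \<le> norm (b1 - b2)"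
    by (simp only: norm_minus_commute[of b1])
  then show ?thesis using pos by (simp add: field_simps)
qed

text \<open>
  For the remainder \<open>r\<close> of \<open>d = g' - g\<close>, with \<open>e\<close> the increment of \<open>w = b - \<eta> g\<close>, the
  linearised operator at \<open>(b, g)\<close> takes \<open>r\<close> to \<open>e * g' * e\<close>, which is quadratic in \<open>b' - b\<close>.
\<close>

lemma dyson_expansion:
  assumes p: "dyson_point \<gamma> b g" and p': "dyson_point \<gamma> b' g'"
  shows "norm (g' - g + response b g (b' - b)) \<le> (1 + norm \<eta> / \<gamma>\<^sup>2)\<^sup>2 / \<gamma> ^ 3 * (norm (b' - b))\<^sup>2"
proof -
  define k where "k = b' - b"
  define d where "d = g' - g"
  define w where "w = b - \<eta> g"
  define e where "e = k - \<eta> d"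
  define r where "r = d + response b g k"
  have pos: "\<gamma> > 0" using p by (simp add: dyson_point_def)
  have w': "b' - \<eta> g' = w + e"
    by (simp add: w_def e_def k_def d_def blinfun.diff_right)
  have gw: "w * g = 1" "g * w = 1"
    using p dyson_left_inverse[OF p] by (simp_all add: dyson_point_def w_def)
  have gw': "(w + e) * g' = 1" "g' * (w + e) = 1"
    using p' dyson_left_inverse[OF p'] by (simp_all add: dyson_point_def w')
  have a: "w * g' = 1 - e * g'" "g' * w = 1 - g' * e"
    using gw' by (simp_all add: algebra_simps)
  have "w * d * w = w * g' * w - w"
    by (simp add: d_def right_diff_distrib left_diff_distrib gw)
  also have "\<dots> = - e * (g' * w)" by (simp add: a(1) left_diff_distrib mult.assoc)
  also have "\<dots> = e * g' * e - e" by (simp add: a(2) algebra_simps)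
  finally have "w * d * w - \<eta> d = e * g' * e - k"
    by (simp add: e_def)
  moreover have "w * response b g k * w - \<eta> (response b g k) = k"
    using response[OF p] by (simp add: w_def)
  moreover have "w * r * w - \<eta> r
      = (w * d * w - \<eta> d) + (w * response b g k * w - \<eta> (response b g k))"
    unfolding r_def by (simp only: distrib_left distrib_right blinfun.add_right) simp
  ultimately have "w * r * w - \<eta> r = e * g' * e" by simp
  with dyson_linearisation_bounded_below[OF p p, of r]
  have "\<gamma>\<^sup>2 * norm r \<le> norm (e * g' * e)" by (simp add: w_def)
  also have "\<dots> \<le> norm e * (1 / \<gamma>) * norm e"
    using dyson_norm_le[OF p']
    by (intro order_trans[OF norm_mult_ineq] mult_right_mono order_trans[OF norm_mult_ineq] mult_left_mono) auto
  finally have 1: "\<gamma>\<^sup>2 * norm r \<le> (norm e)\<^sup>2 / \<gamma>" by (simp add: power2_eq_square)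
  have "norm e \<le> norm k + norm \<eta> * norm d"
    unfolding e_def by (meson norm_triangle_ineq4 norm_blinfun add_left_mono order_trans)
  also have "\<dots> \<le> norm k + norm \<eta> * (norm k / \<gamma>\<^sup>2)"
    using dyson_lipschitz[OF p' p] by (intro add_left_mono mult_left_mono) (auto simp: k_def d_def)
  also have "\<dots> = (1 + norm \<eta> / \<gamma>\<^sup>2) * norm k" by (simp add: algebra_simps)
  finally have "(norm e)\<^sup>2 \<le> ((1 + norm \<eta> / \<gamma>\<^sup>2) * norm k)\<^sup>2"
    by (intro power_mono) auto
  then have "\<gamma>\<^sup>2 * norm r \<le> ((1 + norm \<eta> / \<gamma>\<^sup>2) * norm k)\<^sup>2 / \<gamma>"
    using 1 pos by (meson divide_right_mono less_imp_le order_trans)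
  then have "norm r \<le> ((1 + norm \<eta> / \<gamma>\<^sup>2) * norm k)\<^sup>2 / \<gamma> / \<gamma>\<^sup>2"
    using pos by (simp only: pos_le_divide_eq zero_less_power mult.commute)
  then show ?thesis
    by (simp add: r_def k_def d_def power2_eq_square power3_eq_cube mult_ac)
qed

end

lemma upper_half_neighbourhood:
  assumes "b \<in> upper_half"
  obtains \<gamma> where "\<gamma> > 0" "\<And>y. dist y b < \<gamma> \<Longrightarrow> y \<in> upper_half_closed \<gamma>"
proof -
  obtain \<gamma> where g: "\<gamma> > 0" "b \<in> upper_half_closed \<gamma>"
    using assms by (auto simp: upper_half_iff_closed)
  show ?thesis
    using upper_half_closed_perturb[OF g(2), of _ "\<gamma> / 2"] g(1)
    by (intro that[of "\<gamma> / 2"]) (auto simp: dist_norm dest!: less_imp_le, metis add.commute diff_add_cancel)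
qed

text \<open>
  A product is differentiable at a zero of one factor as soon as the other factor is continuous.
\<close>

lemma (in bounded_bilinear) has_derivative_of_zero_left:
  assumes f: "(f has_derivative f') (at x)" and "f x = 0" and y: "isCont y x"
  shows "((\<lambda>z. prod (f z) (y z)) has_derivative (\<lambda>k. prod (f' k) (y x))) (at x)"
proof -
  obtain K where K: "K > 0" "\<And>a b. norm (prod a b) \<le> norm a * norm b * K"
    using pos_bounded by blast
  obtain M where M: "M > 0" "\<And>k. norm (f' k) \<le> norm k * M"
    using bounded_linear.pos_bounded[OF has_derivative_bounded_linear[OF f]] by blast
  define q where "q z = norm (f z - f x - f' (z - x)) / norm (z - x)" for z
  have "((\<lambda>z. prod (f z) (y z - y x)) has_derivative (\<lambda>k. 0)) (at x)"
  proof (rule has_derivativeI_sandwich[where e = 1 and H = "\<lambda>z. (q z + M) * norm (y z - y x) * K"])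
    fix z assume "z \<noteq> x"
    then have nz: "norm (z - x) > 0" by simp
    have "norm (f z) \<le> norm (f z - f x - f' (z - x)) + norm (f' (z - x))"
      using norm_triangle_ineq[of "f z - f' (z - x)" "f' (z - x)"] assms(2) by simp
    also have "\<dots> \<le> q z * norm (z - x) + norm (z - x) * M"
      using M(2)[of "z - x"] nz by (intro add_mono) (simp_all add: q_def)
    also have "\<dots> = (q z + M) * norm (z - x)" by (simp add: algebra_simps)
    finally have "norm (f z) \<le> (q z + M) * norm (z - x)" .
    then have "norm (prod (f z) (y z - y x)) \<le> ((q z + M) * norm (z - x)) * norm (y z - y x) * K"
      using K(1) by (intro order_trans[OF K(2)] mult_right_mono) auto
    then show "norm (prod (f z) (y z - y x) - prod (f x) (y x - y x) - 0) / norm (z - x)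
        \<le> (q z + M) * norm (y z - y x) * K"
      using nz by (simp add: zero_right pos_divide_le_eq mult_ac)
  next
    have "(q \<longlongrightarrow> 0) (at x)"
      using f unfolding has_derivative_iff_norm q_def by blast
    moreover have "((\<lambda>z. norm (y z - y x)) \<longlongrightarrow> 0) (at x)"
      using y by (simp add: isCont_def LIM_zero_iff tendsto_norm_zero)
    ultimately have "((\<lambda>z. (q z + M) * norm (y z - y x) * K) \<longlongrightarrow> (0 + M) * 0 * K) (at x)"
      by (intro tendsto_intros)
    then show "((\<lambda>z. (q z + M) * norm (y z - y x) * K) \<longlongrightarrow> 0) (at x)" by simp
  qed auto
  from has_derivative_add[OF this bounded_linear.has_derivative[OF bounded_linear_left f, of "y x"]]
  show ?thesis by (simp add: diff_right)
qed

context two_positive_operator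
begin

lemma solution_has_derivative:
  assumes G: "dyson_solution \<eta> G" and b: "b \<in> upper_half"
  shows "has_complex_frechet_derivative G (\<lambda>k. - response b (G b) k) b"
proof -
  obtain \<gamma> where \<gamma>: "\<gamma> > 0" and near: "\<And>y. dist y b < \<gamma> \<Longrightarrow> y \<in> upper_half_closed \<gamma>"
    using upper_half_neighbourhood[OF b] by blast
  have pt: "dyson_point \<gamma> y (G y)" if "dist y b < \<gamma>" for y
    using dyson_point_of_solution[OF G near[OF that] \<gamma>] .
  have p: "dyson_point \<gamma> b (G b)" using pt \<gamma> by simp
  define C where "C = (1 + norm \<eta> / \<gamma>\<^sup>2)\<^sup>2 / \<gamma> ^ 3"
  have "(G has_derivative (\<lambda>k. - response b (G b) k)) (at b)"
  proof (rule has_derivativeI_sandwich[where e = \<gamma> and H = "\<lambda>y. C * norm (y - b)"])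
    show "bounded_linear (\<lambda>k. - response b (G b) k)"
      using bounded_linear_minus bounded_linear_response[OF p] by blast
    fix y assume y: "y \<noteq> b" "dist y b < \<gamma>"
    then show "norm (G y - G b - - response b (G b) (y - b)) / norm (y - b) \<le> C * norm (y - b)"
      using dyson_expansion[OF p pt[OF y(2)]]
      by (simp add: C_def pos_divide_le_eq power2_eq_square mult.assoc)
  next
    have "((\<lambda>y. C * norm (y - b)) \<longlongrightarrow> C * norm (b - b)) (at b)"
      by (intro tendsto_intros)
    then show "((\<lambda>y. C * norm (y - b)) \<longlongrightarrow> 0) (at b)" by simp
  qed (use \<gamma> in simp)
  moreover have "complex_linear (\<lambda>k. - response b (G b) k)"
    by unfold_locales (simp_all add: response_add[OF p] response_scaleC[OF p])
  ultimately show ?thesis by (simp add: has_complex_frechet_derivative_def)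
qed

lemma solution_isCont:
  assumes "dyson_solution \<eta> G" "b \<in> upper_half"
  shows "isCont G b"
  using solution_has_derivative[OF assms] has_derivative_continuous
  unfolding has_complex_frechet_derivative_def by blast

lemma dyson_point_change_operator:
  assumes \<eta>': "two_positive_operator \<eta>'" and p': "two_positive_operator.dyson_point \<eta>' \<gamma> b g'"
    and r: "norm ((\<eta> - \<eta>') g') \<le> r" "r < \<gamma>"
  shows "dyson_point (\<gamma> - r) (b + (\<eta> - \<eta>') g') g'"
proof -
  interpret \<eta>': two_positive_operator \<eta>' by fact
  have "b + (\<eta> - \<eta>') g' \<in> upper_half_closed (\<gamma> - r)"
    using p' by (intro upper_half_closed_perturb r) (simp add: \<eta>'.dyson_point_def upper_half_closed_def)
  then show ?thesis
    using p' r by (simp add: \<eta>'.dyson_point_def dyson_point_def upper_half_closed_def blinfun.diff_left)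
qed

text \<open>
  A solution \<open>g'\<close> for another operator \<open>\<eta>'\<close> at \<open>b\<close> is the solution for \<open>\<eta>\<close> at the shifted
  point \<open>b + (\<eta> - \<eta>') g'\<close>. The dependence on the operator thus reduces to the dependence on
  \<open>b\<close>, including the uniformity of the remainder.
\<close>

lemma solution_change_operator:
  assumes \<eta>': "two_positive_operator \<eta>'" and p: "dyson_point \<gamma> b g"
    and p': "two_positive_operator.dyson_point \<eta>' \<gamma> b g'"
    and small: "norm (\<eta>' - \<eta>) \<le> \<gamma>\<^sup>2 / 2"
  shows "norm (g' - g) \<le> 4 / \<gamma> ^ 3 * norm (\<eta>' - \<eta>)"
    and "norm (g' - g - response b g ((\<eta>' - \<eta>) g'))
      \<le> (1 + 4 * norm \<eta> / \<gamma>\<^sup>2)\<^sup>2 * 8 / \<gamma> ^ 5 * (norm (\<eta>' - \<eta>))\<^sup>2"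
proof -
  interpret \<eta>': two_positive_operator \<eta>' by fact
  \<comment> \<open>The shift \<open>k\<close> has norm at most \<open>\<gamma> / 2\<close>, so both points lie in the half-plane with bound \<open>\<gamma> / 2\<close>.\<close>
  define k where "k = (\<eta> - \<eta>') g'"
  have pos: "\<gamma> > 0" using p by (simp add: dyson_point_def)
  have "norm k \<le> norm (\<eta> - \<eta>') * (1 / \<gamma>)"
    unfolding k_def using \<eta>'.dyson_norm_le[OF p']
    by (intro order_trans[OF norm_blinfun] mult_left_mono) auto
  then have nk: "norm k \<le> norm (\<eta>' - \<eta>) / \<gamma>" by (simp add: norm_minus_commute)
  also have "\<dots> \<le> \<gamma> / 2"
    using small pos by (simp add: field_simps power2_eq_square)
  finally have "norm ((\<eta> - \<eta>') g') \<le> \<gamma> / 2" by (simp add: k_def)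
  from dyson_point_change_operator[OF \<eta>' p' this] pos
  have q': "dyson_point (\<gamma> / 2) (b + k) g'" by (simp add: k_def)
  have "(\<gamma> / 2) *\<^sub>R 1 \<sqsubseteq> \<gamma> *\<^sub>R (1::'a)" using pos by (intro cstar_le_scaleR_left) auto
  then have q: "dyson_point (\<gamma> / 2) b g"
    using p cstar_le_trans by (auto simp: dyson_point_def)
  have "norm (g' - g) \<le> norm k / (\<gamma> / 2)\<^sup>2"
    using dyson_lipschitz[OF q' q] by simp
  also have "\<dots> \<le> (norm (\<eta>' - \<eta>) / \<gamma>) / (\<gamma> / 2)\<^sup>2"
    by (intro divide_right_mono nk) simp
  finally show "norm (g' - g) \<le> 4 / \<gamma> ^ 3 * norm (\<eta>' - \<eta>)"
    using pos by (simp add: field_simps power2_eq_square power3_eq_cube)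
  have "response b g k = - response b g ((\<eta>' - \<eta>) g')"
    using bounded_linear.linear[OF bounded_linear_response[OF p], THEN linear_neg, of "(\<eta>' - \<eta>) g'"]
    by (simp add: k_def blinfun.diff_left)
  then have "norm (g' - g - response b g ((\<eta>' - \<eta>) g'))
      \<le> (1 + norm \<eta> / (\<gamma> / 2)\<^sup>2)\<^sup>2 / (\<gamma> / 2) ^ 3 * (norm k)\<^sup>2"
    using dyson_expansion[OF q q'] by simp
  also have "\<dots> \<le> (1 + norm \<eta> / (\<gamma> / 2)\<^sup>2)\<^sup>2 / (\<gamma> / 2) ^ 3 * (norm (\<eta>' - \<eta>) / \<gamma>)\<^sup>2"
    using pos by (intro mult_left_mono power_mono nk) auto
  also have "\<dots> = (1 + 4 * norm \<eta> / \<gamma>\<^sup>2)\<^sup>2 * 8 / \<gamma> ^ 5 * (norm (\<eta>' - \<eta>))\<^sup>2"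
    using pos by (simp add: power_divide mult_ac flip: power_Suc2 power_add)
  finally show "norm (g' - g - response b g ((\<eta>' - \<eta>) g'))
      \<le> (1 + 4 * norm \<eta> / \<gamma>\<^sup>2)\<^sup>2 * 8 / \<gamma> ^ 5 * (norm (\<eta>' - \<eta>))\<^sup>2" .
qed

end

text \<open>
  The lower bound for the linearised operators turns convergence of these operators into
  strong convergence of their inverses.
\<close>

lemma response_tendsto:
  assumes "eventually (\<lambda>p. two_positive_operator (\<eta> p) \<and> two_positive_operator.dyson_point (\<eta> p) \<gamma> (b p) (g p)) F"
    and "two_positive_operator \<eta>0" "two_positive_operator.dyson_point \<eta>0 \<gamma> b0 g0"
    and lim: "(\<eta> \<longlongrightarrow> \<eta>0) F" "(b \<longlongrightarrow> b0) F" "(g \<longlongrightarrow> g0) F" "(h \<longlongrightarrow> h0) F"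
  shows "((\<lambda>p. two_positive_operator.response (\<eta> p) (b p) (g p) (h p))
    \<longlongrightarrow> two_positive_operator.response \<eta>0 b0 g0 h0) F"
proof -
  interpret \<eta>0: two_positive_operator \<eta>0 by fact
  define x where "x p = two_positive_operator.response (\<eta> p) (b p) (g p) (h p)" for p
  define x0 where "x0 = \<eta>0.response b0 g0 h0"
  define w where "w p = b p - \<eta> p (g p)" for p
  define q where "q p = h p - (w p * x0 * w p - \<eta> p x0)" for p
  have wlim: "(w \<longlongrightarrow> b0 - \<eta>0 g0) F"
    unfolding w_def by (intro tendsto_diff blinfun.tendsto lim)
  then have "(q \<longlongrightarrow> h0 - ((b0 - \<eta>0 g0) * x0 * (b0 - \<eta>0 g0) - \<eta>0 x0)) F"
    unfolding q_def by (intro tendsto_diff tendsto_mult blinfun.tendsto lim tendsto_const)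
  then have "(q \<longlongrightarrow> 0) F"
    using \<eta>0.response[OF assms(3), of h0] by (simp add: x0_def)
  then have "((\<lambda>p. norm (q p) / \<gamma>\<^sup>2) \<longlongrightarrow> 0) F"
    using tendsto_divide[OF tendsto_norm_zero tendsto_const] assms(3)
    by (fastforce simp: \<eta>0.dyson_point_def)
  moreover have "eventually (\<lambda>p. norm (x p - x0) \<le> norm (q p) / \<gamma>\<^sup>2) F"
    using assms(1)
  proof eventually_elim
    case (elim p)
    interpret \<eta>: two_positive_operator "\<eta> p" using elim by blast
    have p: "\<eta>.dyson_point \<gamma> (b p) (g p)" using elim by blast
    have "w p * (x p - x0) * w p - \<eta> p (x p - x0) = (w p * x p * w p - \<eta> p (x p)) - (w p * x0 * w p - \<eta> p x0)"
      by (simp only: right_diff_distrib left_diff_distrib blinfun.diff_right) simp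
    also have "\<dots> = q p"
      using \<eta>.response[OF p, of "h p"] by (simp add: x_def w_def q_def)
    finally have "\<gamma>\<^sup>2 * norm (x p - x0) \<le> norm (q p)"
      using \<eta>.dyson_linearisation_bounded_below[OF p p, of "x p - x0"] by (simp add: w_def)
    then show ?case
      using p by (simp add: \<eta>.dyson_point_def pos_le_divide_eq mult.commute)
  qed
  ultimately have "((\<lambda>p. x p - x0) \<longlongrightarrow> 0) F"
    by (rule Lim_null_comparison[rotated])
  then show ?thesis by (simp add: LIM_zero_iff x_def x0_def)
qed

context two_positive_operator
begin

text \<open>
  At a fixed base point, \<open>f z = response z (G z) (c z)\<close> solves the linearised equation with
  right-hand side \<open>c z - (w z * f z * w z - w b * f z * w b)\<close>. The bracket is a sum of products
  with one factor \<open>w z - w b\<close>, so continuity of \<open>f\<close> is enough to differentiate it.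
\<close>

lemma response_holomorphic:
  assumes G: "dyson_solution \<eta> G" and c: "cstar_holomorphic_on c upper_half"
  shows "cstar_holomorphic_on (\<lambda>z. response z (G z) (c z)) upper_half"
  unfolding cstar_holomorphic_on_def
proof
  fix b :: 'a assume b: "b \<in> upper_half"
  define f where "f z = response z (G z) (c z)" for z
  define w where "w z = z - \<eta> (G z)" for z
  define DG where "DG k = - response b (G b) k" for k
  obtain \<gamma> where \<gamma>: "\<gamma> > 0" and near: "\<And>y. dist y b < \<gamma> \<Longrightarrow> y \<in> upper_half_closed \<gamma>"
    using upper_half_neighbourhood[OF b] by blast
  have pt: "dyson_point \<gamma> y (G y)" if "dist y b < \<gamma>" for y
    using dyson_point_of_solution[OF G near[OF that] \<gamma>] .
  have p: "dyson_point \<gamma> b (G b)" using pt \<gamma> by simp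
  obtain c' where c': "(c has_derivative c') (at b)" "complex_linear c'"
    using c b unfolding cstar_holomorphic_on_def has_complex_frechet_derivative_def by blast
  have DG: "(G has_derivative DG) (at b)" "complex_linear DG"
    using solution_has_derivative[OF G b]
    unfolding has_complex_frechet_derivative_def DG_def by auto
  define w' where "w' k = k - \<eta> (DG k)" for k
  have w': "((\<lambda>z. w z - w b) has_derivative w') (at b)"
    unfolding w_def w'_def by (auto intro!: derivative_eq_intros DG(1) simp: blinfun.diff_right)
  have wcont: "isCont w b"
    unfolding w_def by (intro continuous_intros solution_isCont[OF G b])
  have fcont: "isCont f b"
    unfolding isCont_def f_def
  proof (rule response_tendsto[where \<gamma> = \<gamma>])
    have "eventually (\<lambda>y. dist y b < \<gamma>) (at b)"
      using \<gamma> by (auto simp: eventually_at)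
    then show "eventually (\<lambda>y. two_positive_operator \<eta> \<and> dyson_point \<gamma> y (G y)) (at b)"
      by eventually_elim (use pt two_positive_operator_axioms in blast)
    show "G \<midarrow>b\<rightarrow> G b" using solution_isCont[OF G b] by (simp add: isCont_def)
    show "c \<midarrow>b\<rightarrow> c b" using has_derivative_continuous[OF c'(1)] by (simp add: isCont_def)
  qed (intro two_positive_operator_axioms p tendsto_intros)+
  define q where "q z = c z - ((w z - w b) * (f z * w z) + (w b * f z) * (w z - w b))" for z
  define q' where "q' k = c' k - (w' k * (f b * w b) + (w b * f b) * w' k)" for k
  have "(q has_derivative q') (at b)"
    unfolding q_def q'_def
  proof (intro has_derivative_diff has_derivative_add c')
    show "((\<lambda>z. (w z - w b) * (f z * w z)) has_derivative (\<lambda>k. w' k * (f b * w b))) (at b)"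
      by (rule bounded_bilinear.has_derivative_of_zero_left[OF bounded_bilinear_mult w'])
        (auto intro!: continuous_intros wcont fcont)
    show "((\<lambda>z. (w b * f z) * (w z - w b)) has_derivative (\<lambda>k. (w b * f b) * w' k)) (at b)"
      by (rule bounded_bilinear.has_derivative_of_zero_left[OF
            bounded_bilinear.flip[OF bounded_bilinear_mult] w'])
        (auto intro!: continuous_intros fcont)
  qed
  then have "((\<lambda>z. response b (G b) (q z)) has_derivative (\<lambda>k. response b (G b) (q' k))) (at b)"
    by (rule bounded_linear.has_derivative[OF bounded_linear_response[OF p]])
  then have "(f has_derivative (\<lambda>k. response b (G b) (q' k))) (at b)"
  proof (rule has_derivative_transform_within_open[OF _ open_ball[of b \<gamma>]])
    fix z assume "z \<in> ball b \<gamma>"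
    then have pz: "dyson_point \<gamma> z (G z)" by (intro pt) (simp add: dist_commute)
    have "w z * f z * w z - \<eta> (f z) = c z"
      using response[OF pz] by (simp add: w_def f_def)
    then have "w b * f z * w b - \<eta> (f z) = q z"
      unfolding q_def by (simp add: right_diff_distrib left_diff_distrib mult.assoc algebra_simps)
    then show "response b (G b) (q z) = f z"
      by (intro response_unique[OF p]) (simp add: w_def)
  qed (use \<gamma> in simp)
  moreover have "complex_linear (\<lambda>k. response b (G b) (q' k))"
  proof -
    interpret c': Vector_Spaces.linear scaleC scaleC c' by fact
    interpret DG: Vector_Spaces.linear scaleC scaleC DG by fact
    have "w' (x + y) = w' x + w' y" "w' (a *\<^sub>C x) = a *\<^sub>C w' x" for x y a
      by (simp_all add: w'_def DG.add DG.scale cl.scale blinfun.add_right cvec.scale_right_diff_distrib)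
    then have "q' (x + y) = q' x + q' y" "q' (a *\<^sub>C x) = a *\<^sub>C q' x" for x y a
      by (simp_all add: q'_def c'.add c'.scale distrib_left distrib_right mult_scaleC_left
          mult_scaleC_right cvec.scale_right_diff_distrib cvec.scale_right_distrib)
    then show ?thesis
      by unfold_locales (simp_all add: response_add[OF p] response_scaleC[OF p])
  qed
  ultimately show "\<exists>D. has_complex_frechet_derivative (\<lambda>z. response z (G z) (c z)) D b"
    unfolding has_complex_frechet_derivative_def f_def by blast
qed

end

section \<open>Paths of operators\<close>

lemma C1_path_operator:
  assumes "C1_path_in two_positive_maps T \<eta> \<eta>dot" "t \<in> {0..T}"
  shows "two_positive_operator (\<eta> t)"
  using assms by (auto simp: C1_path_in_def two_positive_maps_def intro: two_positive_operator.intro)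

lemma has_vector_derivative_iff_quotient:
  fixes f :: "real \<Rightarrow> 'a::real_normed_vector"
  shows "(f has_vector_derivative D) (at x within S) \<longleftrightarrow>
    ((\<lambda>y. (1 / (y - x)) *\<^sub>R (f y - f x)) \<longlongrightarrow> D) (at x within S)"
proof -
  have eq: "norm (f y - f x - (y - x) *\<^sub>R D) / \<bar>y - x\<bar> = norm ((1 / (y - x)) *\<^sub>R (f y - f x) - D)"
    if "y \<noteq> x" for y
  proof -
    have "(1 / (y - x)) *\<^sub>R (f y - f x) - D = (1 / (y - x)) *\<^sub>R (f y - f x - (y - x) *\<^sub>R D)"
      using that by (simp add: scaleR_diff_right)
    then show ?thesis by simp
  qed
  have "((\<lambda>y. norm (f y - f x - (y - x) *\<^sub>R D) / norm (y - x)) \<longlongrightarrow> 0) (at x within S)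
      \<longleftrightarrow> ((\<lambda>y. norm ((1 / (y - x)) *\<^sub>R (f y - f x) - D)) \<longlongrightarrow> 0) (at x within S)"
    by (rule filterlim_cong[OF refl refl]) (auto simp: eventually_at_filter eq intro!: always_eventually)
  then show ?thesis
    unfolding has_vector_derivative_def has_derivative_iff_norm
    by (simp add: tendsto_norm_zero_iff LIM_zero_iff bounded_linear_scaleR_left)
qed

text \<open>
  The operators \<open>\<eta>dot t\<close> are only given as real-linear ones, but they are limits of complex-linear
  difference quotients.
\<close>

lemma C1_path_derivative_complex_linear:
  assumes path: "C1_path_in two_positive_maps T \<eta> \<eta>dot" and t: "t \<in> {0..T}" and "T > 0"
  shows "complex_linear (\<eta>dot t)"
proof -
  have "\<eta>dot t (c *\<^sub>C x) = c *\<^sub>C \<eta>dot t x" for c x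
  proof (rule tendsto_unique)
    define Q where "Q s = (1 / (s - t)) *\<^sub>R (\<eta> s - \<eta> t)" for s
    have lim: "(Q \<longlongrightarrow> \<eta>dot t) (at t within {0..T})"
      unfolding Q_def using path t by (simp add: C1_path_in_def has_vector_derivative_iff_quotient)
    show "((\<lambda>s. Q s (c *\<^sub>C x)) \<longlongrightarrow> \<eta>dot t (c *\<^sub>C x)) (at t within {0..T})"
      by (intro blinfun.tendsto lim tendsto_const)
    have "bounded_linear (scaleC c :: 'a \<Rightarrow> 'a)"
      by (rule bounded_linear_intro[where K = "cmod c"])
        (simp_all add: scaleC_add_right scaleR_scaleC scaleC_scaleC norm_scaleC mult.commute)
    then have scaled: "((\<lambda>s. c *\<^sub>C Q s x) \<longlongrightarrow> c *\<^sub>C \<eta>dot t x) (at t within {0..T})"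
      by (rule bounded_linear.tendsto) (intro blinfun.tendsto lim tendsto_const)
    have eq: "c *\<^sub>C Q s x = Q s (c *\<^sub>C x)" if "s \<in> {0..T}" for s
    proof -
      interpret s: two_positive_operator "\<eta> s" by (rule C1_path_operator[OF path that])
      interpret t: two_positive_operator "\<eta> t" by (rule C1_path_operator[OF path t])
      show ?thesis
        by (simp add: Q_def blinfun.scaleR_left blinfun.diff_left s.cl.scale t.cl.scale
            scaleR_scaleC scaleC_scaleC mult.commute flip: cvec.scale_right_diff_distrib)
    qed
    have "\<forall>\<^sub>F s in at t within {0..T}. c *\<^sub>C Q s x = Q s (c *\<^sub>C x)"
      by (auto simp: eventually_at_filter eq intro!: always_eventually)
    with scaled show "((\<lambda>s. Q s (c *\<^sub>C x)) \<longlongrightarrow> c *\<^sub>C \<eta>dot t x) (at t within {0..T})"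
      by (rule Lim_transform_eventually)
    show "at t within {0..T} \<noteq> bot"
      using t \<open>T > 0\<close> by (simp add: trivial_limit_within islimpt_Icc)
  qed
  then show ?thesis
    by unfold_locales (simp_all add: blinfun.add_right)
qed

text \<open>
  The modulus \<open>H\<close> collects the quadratic remainder of the expansion, the error of the difference
  quotient of the path of operators, and the change of the solution inside the linear term.
\<close>

lemma equidifferentiable:
  assumes path: "C1_path_in two_positive_maps T \<eta> \<eta>dot"
    and sol: "\<forall>t\<in>{0..T}. dyson_solution (\<eta> t) (G t)"
    and t0: "t0 \<in> {0..T}" and \<gamma>: "\<gamma> > 0"
  obtains H where "(H \<longlongrightarrow> 0) (at t0 within {0..T})"
    "\<forall>\<^sub>F t in at t0 within {0..T}. \<forall>b\<in>upper_half_closed \<gamma>.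
       norm ((1 / (t - t0)) *\<^sub>R (G t b - G t0 b)
         - two_positive_operator.response (\<eta> t0) b (G t0 b) (\<eta>dot t0 (G t0 b))) \<le> H t"
proof -
  interpret \<eta>0: two_positive_operator "\<eta> t0" by (rule C1_path_operator[OF path t0])
  let ?F = "at t0 within {0..T}"
  define \<Delta> where "\<Delta> t = \<eta> t - \<eta> t0" for t
  define Q where "Q t = (1 / (t - t0)) *\<^sub>R \<Delta> t" for t
  define C where "C = (1 + 4 * norm (\<eta> t0) / \<gamma>\<^sup>2)\<^sup>2 * 8 / \<gamma> ^ 5"
  define H where "H t = C * norm (\<Delta> t) * norm (Q t)
    + (norm (Q t - \<eta>dot t0) * (1 / \<gamma>) + norm (\<eta>dot t0) * (4 / \<gamma> ^ 3 * norm (\<Delta> t))) / \<gamma>\<^sup>2" for t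
  have der: "(\<eta> has_vector_derivative \<eta>dot t0) ?F"
    using path t0 by (simp add: C1_path_in_def)
  then have Q: "(Q \<longlongrightarrow> \<eta>dot t0) ?F"
    by (simp add: has_vector_derivative_iff_quotient Q_def[abs_def] \<Delta>_def[abs_def])
  have "(\<eta> \<longlongrightarrow> \<eta> t0) ?F"
    using has_vector_derivative_continuous[OF der] by (simp add: continuous_within)
  then have \<Delta>: "(\<Delta> \<longlongrightarrow> 0) ?F"
    unfolding \<Delta>_def by (rule LIM_zero)
  have "(H \<longlongrightarrow> C * norm (0 :: 'a \<Rightarrow>\<^sub>L 'a) * norm (\<eta>dot t0)
      + (norm (\<eta>dot t0 - \<eta>dot t0) * (1 / \<gamma>) + norm (\<eta>dot t0) * (4 / \<gamma> ^ 3 * norm (0 :: 'a \<Rightarrow>\<^sub>L 'a))) / \<gamma>\<^sup>2) ?F"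
    unfolding H_def using \<gamma> by (intro tendsto_intros Q \<Delta>) auto
  then have H: "(H \<longlongrightarrow> 0) ?F" by simp
  have "\<forall>\<^sub>F t in ?F. norm (\<Delta> t) < \<gamma>\<^sup>2 / 2"
    using tendsto_norm_zero[OF \<Delta>] \<gamma> by (intro order_tendstoD) auto
  moreover have "\<forall>\<^sub>F t in ?F. t \<in> {0..T}"
    by (auto simp: eventually_at_filter)
  ultimately have "\<forall>\<^sub>F t in ?F. \<forall>b\<in>upper_half_closed \<gamma>.
      norm ((1 / (t - t0)) *\<^sub>R (G t b - G t0 b) - \<eta>0.response b (G t0 b) (\<eta>dot t0 (G t0 b))) \<le> H t"
  proof eventually_elim
    case (elim t)
    show ?case
    proof
      fix b :: 'a assume b: "b \<in> upper_half_closed \<gamma>"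
      interpret \<eta>: two_positive_operator "\<eta> t" by (rule C1_path_operator[OF path elim(2)])
      have p: "\<eta>0.dyson_point \<gamma> b (G t0 b)" and p': "\<eta>.dyson_point \<gamma> b (G t b)"
        using sol t0 elim(2) b \<gamma> \<eta>0.dyson_point_of_solution \<eta>.dyson_point_of_solution by blast+
      define g where "g = G t0 b"
      define g' where "g' = G t b"
      define R where "R = \<eta>0.response b g"
      have bl: "bounded_linear R"
        unfolding R_def g_def by (rule \<eta>0.bounded_linear_response[OF p])
      note change = \<eta>0.solution_change_operator[OF \<eta>.two_positive_operator_axioms p p',
          folded g_def g'_def, folded \<Delta>_def R_def]
      have small: "norm (\<Delta> t) \<le> \<gamma>\<^sup>2 / 2" using elim(1) by simp
      have e1: "norm ((1 / (t - t0)) *\<^sub>R (g' - g - R (\<Delta> t g'))) \<le> C * norm (\<Delta> t) * norm (Q t)"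
      proof -
        have "norm ((1 / (t - t0)) *\<^sub>R (g' - g - R (\<Delta> t g')))
            \<le> \<bar>1 / (t - t0)\<bar> * (C * (norm (\<Delta> t))\<^sup>2)"
          using change(2)[OF small] unfolding norm_scaleR C_def by (intro mult_left_mono) auto
        also have "\<dots> = C * norm (\<Delta> t) * norm (Q t)"
          by (simp add: Q_def power2_eq_square)
        finally show ?thesis .
      qed
      have "norm ((Q t - \<eta>dot t0) g' + \<eta>dot t0 (g' - g))
          \<le> norm (Q t - \<eta>dot t0) * norm g' + norm (\<eta>dot t0) * norm (g' - g)"
        by (intro order_trans[OF norm_triangle_ineq] add_mono norm_blinfun)
      also have "\<dots> \<le> norm (Q t - \<eta>dot t0) * (1 / \<gamma>) + norm (\<eta>dot t0) * (4 / \<gamma> ^ 3 * norm (\<Delta> t))"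
        using change(1)[OF small] \<eta>.dyson_norm_le[OF p']
        by (intro add_mono mult_left_mono) (auto simp: g'_def)
      finally have "norm ((Q t - \<eta>dot t0) g' + \<eta>dot t0 (g' - g)) / \<gamma>\<^sup>2 \<le> \<dots> / \<gamma>\<^sup>2"
        by (intro divide_right_mono) auto
      with \<eta>0.response_norm_le[OF p, of "(Q t - \<eta>dot t0) g' + \<eta>dot t0 (g' - g)"]
      have e2: "norm (R ((Q t - \<eta>dot t0) g' + \<eta>dot t0 (g' - g))) \<le>
          (norm (Q t - \<eta>dot t0) * (1 / \<gamma>) + norm (\<eta>dot t0) * (4 / \<gamma> ^ 3 * norm (\<Delta> t))) / \<gamma>\<^sup>2"
        by (simp add: R_def g_def)
      have "(Q t - \<eta>dot t0) g' + \<eta>dot t0 (g' - g) = (1 / (t - t0)) *\<^sub>R \<Delta> t g' - \<eta>dot t0 g"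
        by (simp add: Q_def blinfun.diff_left blinfun.diff_right blinfun.scaleR_left)
      then have "(1 / (t - t0)) *\<^sub>R (g' - g) - R (\<eta>dot t0 g)
          = (1 / (t - t0)) *\<^sub>R (g' - g - R (\<Delta> t g')) + R ((Q t - \<eta>dot t0) g' + \<eta>dot t0 (g' - g))"
        using bl by (simp add: bounded_linear.linear linear_diff linear_scale scaleR_diff_right)
      then have "norm ((1 / (t - t0)) *\<^sub>R (g' - g) - R (\<eta>dot t0 g)) \<le> H t"
        using norm_triangle_le[OF add_mono[OF e1 e2]] by (simp only: H_def)
      then show "norm ((1 / (t - t0)) *\<^sub>R (G t b - G t0 b)
          - \<eta>0.response b (G t0 b) (\<eta>dot t0 (G t0 b))) \<le> H t"
        by (simp add: g_def g'_def R_def)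
    qed
  qed
  with H that show ?thesis by blast
qed

text \<open>
  Joint limits in \<open>(t, b)\<close> are controlled by changing the operator at fixed \<open>b\<close>, which is uniform
  on a closed half-plane, and then moving \<open>b\<close> for the fixed operator.
\<close>

lemma path_solution_tendsto:
  assumes path: "C1_path_in two_positive_maps T \<eta> \<eta>dot"
    and sol: "\<forall>t\<in>{0..T}. dyson_solution (\<eta> t) (G t)"
    and t0: "t0 \<in> {0..T}" and b0: "b0 \<in> upper_half"
    and lim: "(\<tau> \<longlongrightarrow> t0) F" "(\<beta> \<longlongrightarrow> b0) F" and mem: "\<forall>\<^sub>F p in F. \<tau> p \<in> {0..T}"
  shows "((\<lambda>p. \<eta> (\<tau> p)) \<longlongrightarrow> \<eta> t0) F" "((\<lambda>p. G (\<tau> p) (\<beta> p)) \<longlongrightarrow> G t0 b0) F"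
proof -
  interpret \<eta>0: two_positive_operator "\<eta> t0" by (rule C1_path_operator[OF path t0])
  have "continuous_on {0..T} \<eta>"
    using path by (intro continuous_on_vector_derivative) (auto simp: C1_path_in_def)
  then show \<eta>lim: "((\<lambda>p. \<eta> (\<tau> p)) \<longlongrightarrow> \<eta> t0) F"
    by (rule continuous_on_tendsto_compose) fact+
  obtain \<gamma> where \<gamma>: "\<gamma> > 0" and near: "\<And>y. dist y b0 < \<gamma> \<Longrightarrow> y \<in> upper_half_closed \<gamma>"
    using upper_half_neighbourhood[OF b0] by blast
  have G0: "((\<lambda>p. G t0 (\<beta> p)) \<longlongrightarrow> G t0 b0) F"
    using \<eta>0.solution_isCont[OF _ b0] sol t0 lim(2) isCont_tendsto_compose by blast
  have "\<forall>\<^sub>F p in F. norm (\<eta> (\<tau> p) - \<eta> t0) < \<gamma>\<^sup>2 / 2"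
    using tendsto_norm_zero[OF LIM_zero[OF \<eta>lim]] \<gamma> by (intro order_tendstoD) auto
  moreover have "\<forall>\<^sub>F p in F. dist (\<beta> p) b0 < \<gamma>"
    using lim(2) \<gamma> by (rule tendstoD)
  ultimately have bound: "\<forall>\<^sub>F p in F. norm (G (\<tau> p) (\<beta> p) - G t0 b0)
      \<le> 4 / \<gamma> ^ 3 * norm (\<eta> (\<tau> p) - \<eta> t0) + norm (G t0 (\<beta> p) - G t0 b0)"
    using mem
  proof eventually_elim
    case (elim p)
    interpret \<eta>: two_positive_operator "\<eta> (\<tau> p)" by (rule C1_path_operator[OF path elim(3)])
    have b: "\<beta> p \<in> upper_half_closed \<gamma>" using near elim(2) by blast
    have p: "\<eta>0.dyson_point \<gamma> (\<beta> p) (G t0 (\<beta> p))" and p': "\<eta>.dyson_point \<gamma> (\<beta> p) (G (\<tau> p) (\<beta> p))"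
      using sol t0 elim(3) b \<gamma> \<eta>0.dyson_point_of_solution \<eta>.dyson_point_of_solution by blast+
    have "norm (G (\<tau> p) (\<beta> p) - G t0 (\<beta> p)) \<le> 4 / \<gamma> ^ 3 * norm (\<eta> (\<tau> p) - \<eta> t0)"
      using \<eta>0.solution_change_operator(1)[OF \<eta>.two_positive_operator_axioms p p'] elim(1) by simp
    then show ?case
      using norm_triangle_ineq[of "G (\<tau> p) (\<beta> p) - G t0 (\<beta> p)" "G t0 (\<beta> p) - G t0 b0"] by simp
  qed
  have "((\<lambda>p. 4 / \<gamma> ^ 3 * norm (\<eta> (\<tau> p) - \<eta> t0) + norm (G t0 (\<beta> p) - G t0 b0))
      \<longlongrightarrow> 4 / \<gamma> ^ 3 * norm (\<eta> t0 - \<eta> t0) + norm (G t0 b0 - G t0 b0)) F"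
    by (intro tendsto_intros \<eta>lim G0)
  then have "((\<lambda>p. 4 / \<gamma> ^ 3 * norm (\<eta> (\<tau> p) - \<eta> t0) + norm (G t0 (\<beta> p) - G t0 b0)) \<longlongrightarrow> 0) F"
    by simp
  with bound have "((\<lambda>p. G (\<tau> p) (\<beta> p) - G t0 b0) \<longlongrightarrow> 0) F"
    by (rule Lim_null_comparison)
  then show "((\<lambda>p. G (\<tau> p) (\<beta> p)) \<longlongrightarrow> G t0 b0) F"
    by (simp add: LIM_zero_iff)
qed

theorem theorem1p3:
  fixes T :: real
    and \<eta> \<eta>dot :: "real \<Rightarrow> ('a::unital_cstar_algebra \<Rightarrow>\<^sub>L 'a)"
    and G :: "real \<Rightarrow> 'a \<Rightarrow> 'a"
  assumes "T > 0"
    and "C1_path_in two_positive_maps T \<eta> \<eta>dot"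
    and "\<forall>t\<in>{0..T}. dyson_solution (\<eta> t) (G t)"
  shows "\<exists>Gdot :: real \<Rightarrow> 'a \<Rightarrow> 'a.
    (\<forall>t\<in>{0..T}. \<forall>b\<in>upper_half.
       ((\<lambda>s. G s b) has_vector_derivative Gdot t b) (at t within {0..T})) \<and>
    (\<forall>\<gamma>>0. \<forall>t0\<in>{0..T}.
       ((\<lambda>t. SUP b\<in>upper_half_closed \<gamma>.
           ereal (norm ((1 / (t - t0)) *\<^sub>R (G t b - G t0 b) - Gdot t0 b)))
         \<longlongrightarrow> 0) (at t0 within {0..T})) \<and>
    (\<forall>t\<in>{0..T}. \<forall>b\<in>upper_half. \<exists>DG.
       has_complex_frechet_derivative (G t) DG b \<and>
       Gdot t b = - DG (\<eta>dot t (G t b))) \<and>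
    continuous_on ({0..T} \<times> upper_half) (\<lambda>(t, b). Gdot t b) \<and>
    (\<forall>t\<in>{0..T}. cstar_holomorphic_on (Gdot t) upper_half)"
proof -
  note path = assms(2) and sol = assms(3)
  define Gdot where
    "Gdot t b = two_positive_operator.response (\<eta> t) b (G t b) (\<eta>dot t (G t b))" for t b
  show ?thesis
  proof (intro exI[of _ Gdot] conjI ballI allI impI)
    fix t b assume t: "t \<in> {0..T}" and b: "b \<in> (upper_half :: 'a set)"
    obtain \<gamma> where \<gamma>: "\<gamma> > 0" "b \<in> upper_half_closed \<gamma>"
      using b by (auto simp: upper_half_iff_closed)
    obtain H where H: "(H \<longlongrightarrow> 0) (at t within {0..T})"
      "\<forall>\<^sub>F s in at t within {0..T}. \<forall>b\<in>upper_half_closed \<gamma>.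
         norm ((1 / (s - t)) *\<^sub>R (G s b - G t b) - Gdot t b) \<le> H s"
      unfolding Gdot_def using equidifferentiable[OF path sol t \<gamma>(1)] .
    have "\<forall>\<^sub>F s in at t within {0..T}. norm ((1 / (s - t)) *\<^sub>R (G s b - G t b) - Gdot t b) \<le> H s"
      using H(2) by eventually_elim (use \<gamma>(2) in blast)
    then have "((\<lambda>s. (1 / (s - t)) *\<^sub>R (G s b - G t b) - Gdot t b) \<longlongrightarrow> 0) (at t within {0..T})"
      using H(1) by (rule Lim_null_comparison)
    then show "((\<lambda>s. G s b) has_vector_derivative Gdot t b) (at t within {0..T})"
      by (simp only: has_vector_derivative_iff_quotient LIM_zero_iff)
  next
    fix \<gamma> t0 :: real assume \<gamma>: "\<gamma> > 0" and t0: "t0 \<in> {0..T}"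
    let ?S = "\<lambda>t. SUP b\<in>upper_half_closed \<gamma>.
        ereal (norm ((1 / (t - t0)) *\<^sub>R (G t b - G t0 b) - Gdot t0 b))"
    obtain H where H: "(H \<longlongrightarrow> 0) (at t0 within {0..T})"
      "\<forall>\<^sub>F t in at t0 within {0..T}. \<forall>b\<in>upper_half_closed \<gamma>.
         norm ((1 / (t - t0)) *\<^sub>R (G t b - G t0 b) - Gdot t0 b) \<le> H t"
      unfolding Gdot_def using equidifferentiable[OF path sol t0 \<gamma>] .
    obtain b :: 'a where "b \<in> upper_half_closed \<gamma>"
      using upper_half_closed_nonempty by blast
    then have "0 \<le> ?S t" for t
      by (intro SUP_upper2[of b]) auto
    moreover have "\<forall>\<^sub>F t in at t0 within {0..T}. ?S t \<le> ereal (H t)"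
      using H(2) by eventually_elim (intro SUP_least, simp)
    moreover have "((\<lambda>t. ereal (H t)) \<longlongrightarrow> 0) (at t0 within {0..T})"
      using H(1) by (simp add: zero_ereal_def)
    ultimately show "(?S \<longlongrightarrow> 0) (at t0 within {0..T})"
      by (intro tendsto_sandwich[of "\<lambda>_. 0" ?S _ "\<lambda>t. ereal (H t)"]) auto
  next
    fix t b assume t: "t \<in> {0..T}" and b: "b \<in> (upper_half :: 'a set)"
    interpret \<eta>: two_positive_operator "\<eta> t" by (rule C1_path_operator[OF path t])
    show "\<exists>DG. has_complex_frechet_derivative (G t) DG b \<and> Gdot t b = - DG (\<eta>dot t (G t b))"
    proof (intro exI conjI)
      show "has_complex_frechet_derivative (G t) (\<lambda>k. - \<eta>.response b (G t b) k) b"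
        using sol t by (intro \<eta>.solution_has_derivative[OF _ b]) blast
    qed (simp add: Gdot_def)
  next
    show "continuous_on ({0..T} \<times> upper_half) (\<lambda>(t, b). Gdot t b)"
      unfolding continuous_on_def
    proof clarify
      fix t0 and b0 :: 'a assume t0: "t0 \<in> {0..T}" and b0: "b0 \<in> upper_half"
      let ?F = "at (t0, b0) within {0..T} \<times> upper_half"
      interpret \<eta>0: two_positive_operator "\<eta> t0" by (rule C1_path_operator[OF path t0])
      obtain \<gamma> where \<gamma>: "\<gamma> > 0" and near: "\<And>y. dist y b0 < \<gamma> \<Longrightarrow> y \<in> upper_half_closed \<gamma>"
        using upper_half_neighbourhood[OF b0] by blast
      have lim: "(fst \<longlongrightarrow> t0) ?F" "(snd \<longlongrightarrow> b0) ?F"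
        using tendsto_fst[OF tendsto_ident_at] tendsto_snd[OF tendsto_ident_at] by fastforce+
      have mem: "\<forall>\<^sub>F p in ?F. fst p \<in> {0..T}"
        by (auto simp: eventually_at_filter intro!: always_eventually)
      note lims = path_solution_tendsto[OF path sol t0 b0 lim mem]
      have "continuous_on {0..T} \<eta>dot" using path by (simp add: C1_path_in_def)
      then have \<eta>dot: "((\<lambda>p. \<eta>dot (fst p)) \<longlongrightarrow> \<eta>dot t0) ?F"
        by (rule continuous_on_tendsto_compose) fact+
      have "\<forall>\<^sub>F p in ?F. dist (snd p) b0 < \<gamma>"
        using lim(2) \<gamma> by (rule tendstoD)
      with mem have "\<forall>\<^sub>F p in ?F. two_positive_operator (\<eta> (fst p)) \<and>
          two_positive_operator.dyson_point (\<eta> (fst p)) \<gamma> (snd p) (G (fst p) (snd p))"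
      proof eventually_elim
        case (elim p)
        with C1_path_operator[OF path elim(1)] near sol \<gamma> show ?case
          by (auto intro: two_positive_operator.dyson_point_of_solution)
      qed
      moreover have "\<eta>0.dyson_point \<gamma> b0 (G t0 b0)"
        using sol t0 near \<gamma> by (auto intro: \<eta>0.dyson_point_of_solution)
      ultimately have "((\<lambda>p. Gdot (fst p) (snd p)) \<longlongrightarrow> Gdot t0 b0) ?F"
        unfolding Gdot_def
        by (intro response_tendsto[where \<gamma> = \<gamma>] \<eta>0.two_positive_operator_axioms lims lim
            blinfun.tendsto \<eta>dot)
      then show "((\<lambda>(t, b). Gdot t b) \<longlongrightarrow> Gdot t0 b0) ?F"
        by (simp add: case_prod_unfold)
    qed
  next
    fix t assume t: "t \<in> {0..T}"
    interpret \<eta>: two_positive_operator "\<eta> t" by (rule C1_path_operator[OF path t])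
    interpret d: Vector_Spaces.linear scaleC scaleC "blinfun_apply (\<eta>dot t)"
      by (rule C1_path_derivative_complex_linear[OF path t assms(1)])
    have "cstar_holomorphic_on (\<lambda>b. \<eta>dot t (G t b)) upper_half"
      unfolding cstar_holomorphic_on_def
    proof
      fix b :: 'a assume b: "b \<in> upper_half"
      obtain D where D: "(G t has_derivative D) (at b)" "complex_linear D"
        using \<eta>.solution_has_derivative[OF _ b] sol t
        unfolding has_complex_frechet_derivative_def by blast
      interpret D: Vector_Spaces.linear scaleC scaleC D by fact
      have "complex_linear (\<lambda>k. \<eta>dot t (D k))"
        by unfold_locales (simp_all add: D.add D.scale d.add d.scale)
      moreover have "((\<lambda>b. \<eta>dot t (G t b)) has_derivative (\<lambda>k. \<eta>dot t (D k))) (at b)"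
        by (rule bounded_linear.has_derivative[OF blinfun.bounded_linear_right D(1)])
      ultimately show "\<exists>D. has_complex_frechet_derivative (\<lambda>b. \<eta>dot t (G t b)) D b"
        unfolding has_complex_frechet_derivative_def by blast
    qed
    with \<eta>.response_holomorphic sol t show "cstar_holomorphic_on (Gdot t) upper_half"
      unfolding Gdot_def[abs_def] by blast
  qed
qed

end
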